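(* Let $d\ge1$, $p>2$, $T>0$, and let $\Omega\subseteq\mathbb{R}^d$ be an open set. Then a continuous function $u$ is a viscosity solution of $$(\partial_tu(x,t))^{p-1}=\Delta_pu(x,t)\quad\text{for all }(x,t)\in\Omega\times(0,T)$$ if and only if $u$ is a viscosity solution of the asymptotic mean value formula $$\mathcal{A}_\epsilon[u](x,t)=u(x,t+\epsilon^2/2)+o(\epsilon^2)\quad\text{as }\epsilon\to0^+\quad\text{for all }(x,t)\in\Omega\times(0,T).$$
   Context: Signed powers: $(s)^q=\operatorname{sgn}(s)|s|^q$ for $s\in\mathbb{R}$, $q>0$. $B_r(x)$ is the ball of radius $r$ centered at $x$. $\Delta_p$ acts in space: $\Delta_p\varphi=\nabla\cdot(|\nabla\varphi|^{p-2}\nabla\varphi)$, i.e. for $\varphi\in C^2$, $\Delta_p\varphi=|\nabla\varphi|^{p-2}\big(\Delta\varphi+(p-2)\langle D^2\varphi\frac{\nabla\varphi}{|\nabla\varphi|},\frac{\nabla\varphi}{|\nabla\varphi|}\rangle\big)$ where $\nabla\varphi\ne0$, and $\Delta_p\varphi=0$ where $\nabla\varphi=0$. Set $\alpha=\frac{p-2}{p-1}$, $\beta=\frac{p-2}{p+d}$, $\gamma=\sqrt{2(p+d)}$, $m(\epsilon)=\epsilon^{\frac{2(p-1)}{3p-4}}$, $M(\epsilon)=\epsilon^{-2+\frac2p}$. For $\rho>0$, $$M_\rho[\varphi](x)=\frac\beta2\Big(\sup_{B_{\gamma\rho}(x)}\varphi+\inf_{B_{\gamma\rho}(x)}\varphi\Big)+(1-\beta)\frac{1}{|B_{\gamma\rho}(x)|}\int_{B_{\gamma\rho}(x)}\varphi(y)\,dy,$$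 and $$\mathcal{A}_\epsilon[\varphi](x)=\frac12\max\Big[\inf_{c\in[m(\epsilon),M(\epsilon)]}\Big\{\alpha\sup_{B_{\epsilon^2c^{1-\alpha}}(x)}\varphi+(1-\alpha)M_{\epsilon c^{-\alpha/2}}[\varphi](x)\Big\},\varphi(x)\Big]+\frac12\min\Big[\sup_{c\in[m(\epsilon),M(\epsilon)]}\Big\{\alpha\inf_{B_{\epsilon^2c^{1-\alpha}}(x)}\varphi+(1-\alpha)M_{\epsilon c^{-\alpha/2}}[\varphi](x)\Big\},\varphi(x)\Big].$$ For $\varphi$ depending on $(x,t)$, $\mathcal{A}_\epsilon[\varphi](x,t)=\mathcal{A}_\epsilon[\varphi(\cdot,t)](x)$. Touching: let $(x_0,t_0)\in\Omega\times(0,T)$ and $\varphi\in C^2(B_R(x_0)\times[t_0-R,t_0+R])$ for some $R>0$ with $B_R(x_0)\times[t_0-R,t_0+R]\subset\Omega\times(0,T)$. We say $\varphi$ touches $u$ from above (resp. below) at $(x_0,t_0)$ if $\varphi(x_0,t_0)=u(x_0,t_0)$ and $\varphi>u$ (resp. $\varphi<u$) in $B_R(x_0)\times[t_0-R,t_0]$ except at $(x_0,t_0)$. Viscosity solution of the equation: a bounded upper (resp. lower) semicontinuous $u:\Omega\times(0,T)\to\mathbb{R}$ is a viscosity subsolution (resp. supersolution) if $(\partial_t\varphi(x_0,t_0))^{p-1}\le\Delta_p\varphi(x_0,t_0)$ (resp. $\ge$) whenever such a $\varphi$ touches $u$ from above (resp. below) at $(x_0,t_0)$. A bounded continuous $u$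 is a viscosity solution if it is both. Viscosity solution of the asymptotic mean value formula: a bounded upper (resp. lower) semicontinuous $u$ is a viscosity subsolution (resp. supersolution) if, whenever such a $\varphi$ touches $u$ from above (resp. below) at $(x_0,t_0)$, $$\liminf_{\epsilon\to0^+}\frac{\mathcal{A}_\epsilon[\varphi](x_0,t_0)-\varphi(x_0,t_0+\epsilon^2/2)}{\epsilon^2}\ge0\qquad\Big(\text{resp. }\limsup_{\epsilon\to0^+}\frac{\mathcal{A}_\epsilon[\varphi](x_0,t_0)-\varphi(x_0,t_0+\epsilon^2/2)}{\epsilon^2}\le0\Big).$$ A bounded continuous $u$ is a viscosity solution if it is both. *)

theory Defs
  imports "HOL-Analysis.Analysis"
begin

section \<open>Differential operators\<close>

definition signed_powr :: "real \<Rightarrow> real \<Rightarrow> real" where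
  "signed_powr s q = sgn s * \<bar>s\<bar> powr q"

definition gradient :: "('a::euclidean_space \<Rightarrow> real) \<Rightarrow> 'a \<Rightarrow> 'a" where
  "gradient \<phi> x = (THE D. GDERIV \<phi> x :> D)"

definition divergence :: "('a::euclidean_space \<Rightarrow> 'a) \<Rightarrow> 'a \<Rightarrow> real" where
  "divergence F x = (\<Sum>b\<in>Basis. frechet_derivative F (at x) b \<bullet> b)"

definition p_laplacian :: "real \<Rightarrow> ('a::euclidean_space \<Rightarrow> real) \<Rightarrow> 'a \<Rightarrow> real" where
  "p_laplacian p \<phi> = divergence (\<lambda>y. norm (gradient \<phi> y) powr (p - 2) *\<^sub>R gradient \<phi> y)"

text \<open>
  The divergence form makes sense at critical points too: for \<open>p > 2\<close> it agrees with
  the non-divergence form, with the value \<open>0\<close> where the gradient vanishes.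
\<close>

lemma p_laplacian_nondivergence_form:
  fixes \<phi> :: "'a::euclidean_space \<Rightarrow> real" and x :: 'a
  defines "g \<equiv> gradient \<phi> x" and "H \<equiv> frechet_derivative (gradient \<phi>) (at x)"
  assumes p: "p > 2" and diff: "gradient \<phi> differentiable (at x)"
  shows "p_laplacian p \<phi> x =
    (if g = 0 then 0
     else norm g powr (p - 2) *
       (divergence (gradient \<phi>) x + (p - 2) * (H (g /\<^sub>R norm g) \<bullet> (g /\<^sub>R norm g))))"
proof -
  let ?F = "\<lambda>y. norm (gradient \<phi> y) powr (p - 2) *\<^sub>R gradient \<phi> y"
  have dH: "(gradient \<phi> has_derivative H) (at x)"
    using diff unfolding H_def by (simp add: frechet_derivative_works)
  show ?thesis
  proof (cases "g = 0")
    case True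
    have dom: "((\<lambda>v. norm v powr (p - 2) *\<^sub>R v) has_derivative (\<lambda>v. 0)) (at (0::'a))"
    proof -
      have lim: "((\<lambda>v. norm v powr (p - 2)) \<longlongrightarrow> 0) (at (0::'a))"
        using tendsto_powr'[of norm 0 "at (0::'a)" "\<lambda>_. p - 2" "p - 2"] p
        by (simp add: tendsto_norm_zero)
      have "((\<lambda>v. norm ((norm v powr (p - 2)) *\<^sub>R v) / norm v) \<longlongrightarrow> 0) (at (0::'a))"
        by (rule Lim_transform_eventually[OF lim]) (simp add: eventually_at_filter)
      then show ?thesis by (simp add: has_derivative_at)
    qed
    have "(?F has_derivative (\<lambda>v. 0)) (at x)"
      using has_derivative_compose[OF dH, of "\<lambda>v. norm v powr (p - 2) *\<^sub>R v" "\<lambda>v. 0"] dom True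
      by (simp add: g_def)
    then have "frechet_derivative ?F (at x) = (\<lambda>v. 0)"
      by (rule frechet_derivative_at[symmetric])
    with True show ?thesis by (simp add: p_laplacian_def divergence_def)
  next
    case False
    then have ng: "norm g > 0" by simp
    have dn: "((\<lambda>y. norm (gradient \<phi> y)) has_derivative (\<lambda>v. H v \<bullet> sgn g)) (at x)"
      using has_derivative_compose[OF dH has_derivative_norm] False by (simp add: g_def)
    have dp: "((\<lambda>y. norm (gradient \<phi> y) powr (p - 2)) has_derivative
        (\<lambda>v. (p - 2) * norm g powr (p - 3) * (H v \<bullet> sgn g))) (at x)"
    proof -
      have "((\<lambda>r. r powr (p - 2)) has_real_derivative (p - 2) * norm g powr (p - 2 - 1)) (at (norm g))"
        using ng by (rule has_real_derivative_powr)
      then have "((\<lambda>r. r powr (p - 2)) has_derivative (*) ((p - 2) * norm g powr (p - 3))) (at (norm g))"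
        by (simp add: has_field_derivative_def)
      from has_derivative_compose[OF dn this[unfolded g_def]] show ?thesis
        by (simp add: g_def)
    qed
    have "(?F has_derivative (\<lambda>v. norm g powr (p - 2) *\<^sub>R H v
        + ((p - 2) * norm g powr (p - 3) * (H v \<bullet> sgn g)) *\<^sub>R g)) (at x)"
      using has_derivative_scaleR[OF dp dH] by (simp add: g_def)
    then have F': "frechet_derivative ?F (at x) = (\<lambda>v. norm g powr (p - 2) *\<^sub>R H v
        + ((p - 2) * norm g powr (p - 3) * (H v \<bullet> sgn g)) *\<^sub>R g)"
      by (rule frechet_derivative_at[symmetric])
    have lin: "linear H" using dH by (rule has_derivative_linear)
    have "(\<Sum>b\<in>Basis. (H b \<bullet> sgn g) * (g \<bullet> b)) = H (\<Sum>b\<in>Basis. (g \<bullet> b) *\<^sub>R b) \<bullet> sgn g"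
      by (simp add: linear_sum[OF lin] linear_cmul[OF lin] inner_sum_left mult.commute)
    then have tr: "(\<Sum>b\<in>Basis. (H b \<bullet> sgn g) * (g \<bullet> b)) = H g \<bullet> sgn g"
      by (simp add: euclidean_representation)
    have pw: "norm g powr (p - 3) = norm g powr (p - 2) / norm g"
      using powr_diff[of "norm g" "p - 2" 1] ng by simp
    have "p_laplacian p \<phi> x = norm g powr (p - 2) * divergence (gradient \<phi>) x
        + (p - 2) * norm g powr (p - 3) * (\<Sum>b\<in>Basis. (H b \<bullet> sgn g) * (g \<bullet> b))"
      unfolding p_laplacian_def divergence_def F'
      by (simp add: H_def inner_add_left sum.distrib sum_distrib_left mult.assoc)
    also have "\<dots> = norm g powr (p - 2) *
        (divergence (gradient \<phi>) x + (p - 2) * (H (g /\<^sub>R norm g) \<bullet> (g /\<^sub>R norm g)))"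
      unfolding tr pw using ng
      by (simp add: linear_cmul[OF lin] sgn_div_norm divide_simps) (simp add: algebra_simps)
    finally show ?thesis using False by simp
  qed
qed

section \<open>The averaging operators\<close>

definition exp_alpha :: "real \<Rightarrow> real" where
  "exp_alpha p = (p - 2) / (p - 1)"

definition coef_beta :: "real \<Rightarrow> nat \<Rightarrow> real" where
  "coef_beta p d = (p - 2) / (p + real d)"

definition coef_gamma :: "real \<Rightarrow> nat \<Rightarrow> real" where
  "coef_gamma p d = sqrt (2 * (p + real d))"

definition lower_cutoff :: "real \<Rightarrow> real \<Rightarrow> real" where
  "lower_cutoff p \<epsilon> = \<epsilon> powr (2 * (p - 1) / (3 * p - 4))"

definition upper_cutoff :: "real \<Rightarrow> real \<Rightarrow> real" where
  "upper_cutoff p \<epsilon> = \<epsilon> powr (- 2 + 2 / p)"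

definition mean_op :: "real \<Rightarrow> real \<Rightarrow> ('a::euclidean_space \<Rightarrow> real) \<Rightarrow> 'a \<Rightarrow> real" where
  "mean_op p \<rho> \<phi> x =
    (let \<beta> = coef_beta p DIM('a);
         B = ball x (coef_gamma p DIM('a) * \<rho>)
     in \<beta> / 2 * ((SUP y\<in>B. \<phi> y) + (INF y\<in>B. \<phi> y))
        + (1 - \<beta>) * (1 / measure lborel B * (LINT y:B|lborel. \<phi> y)))"

definition A_op :: "real \<Rightarrow> real \<Rightarrow> ('a::euclidean_space \<Rightarrow> real) \<Rightarrow> 'a \<Rightarrow> real" where
  "A_op p \<epsilon> \<phi> x =
    (let \<alpha> = exp_alpha p;
         I = {lower_cutoff p \<epsilon> .. upper_cutoff p \<epsilon>}
     in 1 / 2 * max (INF c\<in>I. \<alpha> * (SUP y\<in>ball x (\<epsilon>\<^sup>2 * c powr (1 - \<alpha>)). \<phi> y)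
                              + (1 - \<alpha>) * mean_op p (\<epsilon> * c powr (- \<alpha> / 2)) \<phi> x)
                    (\<phi> x)
      + 1 / 2 * min (SUP c\<in>I. \<alpha> * (INF y\<in>ball x (\<epsilon>\<^sup>2 * c powr (1 - \<alpha>)). \<phi> y)
                              + (1 - \<alpha>) * mean_op p (\<epsilon> * c powr (- \<alpha> / 2)) \<phi> x)
                    (\<phi> x))"

text \<open>
  A test function is only controlled near the base point, and \<open>Sup\<close>, \<open>Inf\<close> on
  \<^typ>\<open>real\<close> are unspecified on unbounded sets. This is harmless in the limit
  \<open>\<epsilon> \<rightarrow> 0+\<close>: for \<open>p > 2\<close> the largest radii occurring in \<^const>\<open>A_op\<close> are
  \<open>\<epsilon> powr (2 - 2 / p)\<close> and a constant multiple of
  \<open>\<epsilon> powr (2 * (p - 1) / (3 * p - 4))\<close>, and both tend to \<open>0\<close>.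
\<close>

definition amvf_quotient ::
    "real \<Rightarrow> ('a::euclidean_space \<times> real \<Rightarrow> real) \<Rightarrow> 'a \<Rightarrow> real \<Rightarrow> real \<Rightarrow> real" where
  "amvf_quotient p \<phi> x t \<epsilon> =
    (A_op p \<epsilon> (\<lambda>y. \<phi> (y, t)) x - \<phi> (x, t + \<epsilon>\<^sup>2 / 2)) / \<epsilon>\<^sup>2"

section \<open>Semicontinuity, test functions and viscosity solutions\<close>

definition usc_on :: "'b::topological_space set \<Rightarrow> ('b \<Rightarrow> real) \<Rightarrow> bool" where
  "usc_on S u \<longleftrightarrow> (\<forall>z\<in>S. \<forall>c>u z. \<forall>\<^sub>F w in at z within S. u w < c)"

definition lsc_on :: "'b::topological_space set \<Rightarrow> ('b \<Rightarrow> real) \<Rightarrow> bool" where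
  "lsc_on S u \<longleftrightarrow> (\<forall>z\<in>S. \<forall>c<u z. \<forall>\<^sub>F w in at z within S. c < u w)"

text \<open>
  Derivatives are taken within \<open>S\<close>, hence one-sided at the closed time ends of the
  cylinders below; \<open>G\<close> is the gradient and \<open>H\<close> the Hessian.
\<close>

definition C2_on :: "'b::euclidean_space set \<Rightarrow> ('b \<Rightarrow> real) \<Rightarrow> bool" where
  "C2_on S f \<longleftrightarrow>
    (\<exists>(G :: 'b \<Rightarrow> 'b) (H :: 'b \<Rightarrow> 'b \<Rightarrow>\<^sub>L 'b).
      (\<forall>z\<in>S. (f has_derivative (\<lambda>h. G z \<bullet> h)) (at z within S)) \<and>
      (\<forall>z\<in>S. (G has_derivative blinfun_apply (H z)) (at z within S)) \<and>
      continuous_on S H)"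

definition touches_from_above ::
    "'a::euclidean_space set \<Rightarrow> real \<Rightarrow> ('a \<times> real \<Rightarrow> real) \<Rightarrow> ('a \<times> real \<Rightarrow> real)
      \<Rightarrow> 'a \<Rightarrow> real \<Rightarrow> bool" where
  "touches_from_above \<Omega> T \<phi> u x0 t0 \<longleftrightarrow>
    (x0, t0) \<in> \<Omega> \<times> {0<..<T} \<and>
    (\<exists>R>0. ball x0 R \<times> {t0 - R..t0 + R} \<subseteq> \<Omega> \<times> {0<..<T} \<and>
      C2_on (ball x0 R \<times> {t0 - R..t0 + R}) \<phi> \<and>
      \<phi> (x0, t0) = u (x0, t0) \<and>
      (\<forall>z \<in> ball x0 R \<times> {t0 - R..t0} - {(x0, t0)}. \<phi> z > u z))"

definition touches_from_below ::
    "'a::euclidean_space set \<Rightarrow> real \<Rightarrow> ('a \<times> real \<Rightarrow> real) \<Rightarrow> ('a \<times> real \<Rightarrow> real)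
      \<Rightarrow> 'a \<Rightarrow> real \<Rightarrow> bool" where
  "touches_from_below \<Omega> T \<phi> u x0 t0 \<longleftrightarrow>
    (x0, t0) \<in> \<Omega> \<times> {0<..<T} \<and>
    (\<exists>R>0. ball x0 R \<times> {t0 - R..t0 + R} \<subseteq> \<Omega> \<times> {0<..<T} \<and>
      C2_on (ball x0 R \<times> {t0 - R..t0 + R}) \<phi> \<and>
      \<phi> (x0, t0) = u (x0, t0) \<and>
      (\<forall>z \<in> ball x0 R \<times> {t0 - R..t0} - {(x0, t0)}. \<phi> z < u z))"

definition pde_subsolution ::
    "real \<Rightarrow> 'a::euclidean_space set \<Rightarrow> real \<Rightarrow> ('a \<times> real \<Rightarrow> real) \<Rightarrow> bool" where
  "pde_subsolution p \<Omega> T u \<longleftrightarrow>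
    bounded (u ` (\<Omega> \<times> {0<..<T})) \<and> usc_on (\<Omega> \<times> {0<..<T}) u \<and>
    (\<forall>\<phi> x0 t0. touches_from_above \<Omega> T \<phi> u x0 t0 \<longrightarrow>
      signed_powr (deriv (\<lambda>t. \<phi> (x0, t)) t0) (p - 1) \<le> p_laplacian p (\<lambda>x. \<phi> (x, t0)) x0)"

definition pde_supersolution ::
    "real \<Rightarrow> 'a::euclidean_space set \<Rightarrow> real \<Rightarrow> ('a \<times> real \<Rightarrow> real) \<Rightarrow> bool" where
  "pde_supersolution p \<Omega> T u \<longleftrightarrow>
    bounded (u ` (\<Omega> \<times> {0<..<T})) \<and> lsc_on (\<Omega> \<times> {0<..<T}) u \<and>
    (\<forall>\<phi> x0 t0. touches_from_below \<Omega> T \<phi> u x0 t0 \<longrightarrow>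
      signed_powr (deriv (\<lambda>t. \<phi> (x0, t)) t0) (p - 1) \<ge> p_laplacian p (\<lambda>x. \<phi> (x, t0)) x0)"

definition pde_viscosity_solution ::
    "real \<Rightarrow> 'a::euclidean_space set \<Rightarrow> real \<Rightarrow> ('a \<times> real \<Rightarrow> real) \<Rightarrow> bool" where
  "pde_viscosity_solution p \<Omega> T u \<longleftrightarrow>
    bounded (u ` (\<Omega> \<times> {0<..<T})) \<and> continuous_on (\<Omega> \<times> {0<..<T}) u \<and>
    pde_subsolution p \<Omega> T u \<and> pde_supersolution p \<Omega> T u"

definition amvf_subsolution ::
    "real \<Rightarrow> 'a::euclidean_space set \<Rightarrow> real \<Rightarrow> ('a \<times> real \<Rightarrow> real) \<Rightarrow> bool" where
  "amvf_subsolution p \<Omega> T u \<longleftrightarrow>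
    bounded (u ` (\<Omega> \<times> {0<..<T})) \<and> usc_on (\<Omega> \<times> {0<..<T}) u \<and>
    (\<forall>\<phi> x0 t0. touches_from_above \<Omega> T \<phi> u x0 t0 \<longrightarrow>
      Liminf (at_right 0) (\<lambda>\<epsilon>. ereal (amvf_quotient p \<phi> x0 t0 \<epsilon>)) \<ge> 0)"

definition amvf_supersolution ::
    "real \<Rightarrow> 'a::euclidean_space set \<Rightarrow> real \<Rightarrow> ('a \<times> real \<Rightarrow> real) \<Rightarrow> bool" where
  "amvf_supersolution p \<Omega> T u \<longleftrightarrow>
    bounded (u ` (\<Omega> \<times> {0<..<T})) \<and> lsc_on (\<Omega> \<times> {0<..<T}) u \<and>
    (\<forall>\<phi> x0 t0. touches_from_below \<Omega> T \<phi> u x0 t0 \<longrightarrow>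
      Limsup (at_right 0) (\<lambda>\<epsilon>. ereal (amvf_quotient p \<phi> x0 t0 \<epsilon>)) \<le> 0)"

definition amvf_viscosity_solution ::
    "real \<Rightarrow> 'a::euclidean_space set \<Rightarrow> real \<Rightarrow> ('a \<times> real \<Rightarrow> real) \<Rightarrow> bool" where
  "amvf_viscosity_solution p \<Omega> T u \<longleftrightarrow>
    bounded (u ` (\<Omega> \<times> {0<..<T})) \<and> continuous_on (\<Omega> \<times> {0<..<T}) u \<and>
    amvf_subsolution p \<Omega> T u \<and> amvf_supersolution p \<Omega> T u"

end

theory Submission
  imports Defs
begin

text \<open>
  The quotient in the mean value formula converges at the base point of every \<open>C\<^sup>2\<close> test
  function, critical or not, to \<open>((\<Delta>\<^sub>p \<phi>)\<^sup>1\<^sup>/\<^sup>(\<^sup>p\<^sup>-\<^sup>1\<^sup>) - \<partial>\<^sub>t \<phi>) / 2\<close>, the power being signed. As signed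
  powers are increasing, the two notions of viscosity solution then coincide test function by
  test function.

  For the limit, a second-order expansion turns the bracket at parameter \<open>c\<close> into \<open>\<phi>\<close> plus
  \<open>\<epsilon>\<^sup>2\<close> times \<open>\<alpha> c\<^sup>1\<^sup>-\<^sup>\<alpha> \<bar>\<nabla>\<phi>\<bar> + (1 - \<alpha>) c\<^sup>-\<^sup>\<alpha> L\<close>, where \<open>L\<close> is the normalized
  \<open>p\<close>-Laplacian. By the weighted AM-GM inequality the infimum over \<open>c\<close> is
  \<open>\<bar>\<nabla>\<phi>\<bar>\<^sup>\<alpha> L\<^sup>1\<^sup>-\<^sup>\<alpha>\<close> for \<open>L > 0\<close> and at most \<open>0\<close> otherwise, so the first maximum produces the positive
  part of the limit. Replacing \<open>\<phi>\<close> by \<open>-\<phi>\<close>, the second term produces the negative part.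
\<close>

section \<open>Second moments of the ball\<close>

lemma set_integrable_ball_continuous:
  fixes f :: "'a::euclidean_space \<Rightarrow> real"
  assumes "continuous_on (cball c r) f"
  shows "set_integrable lborel (ball c r) f"
proof -
  have "set_integrable lborel (cball c r) f"
    unfolding set_integrable_def
    using borel_integrable_compact[OF compact_cball assms] by simp
  then show ?thesis
    by (rule set_integrable_subset) auto
qed

text \<open>Change of variables: a norm-preserving map leaves the indicator of a centred ball
  invariant. It is applied to coordinate reflections and to coordinate swaps.\<close>

lemma set_integral_ball_isometry:
  fixes f :: "'a::euclidean_space \<Rightarrow> real"
  assumes T: "distr lborel borel T = lborel" "T \<in> borel_measurable borel" "\<And>h. norm (T h) = norm h"
    and f: "f \<in> borel_measurable borel"
  shows "(LINT h:ball 0 r|lborel. f (T h)) = (LINT h:ball 0 r|lborel. f h)"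
proof -
  have ind: "indicator (ball 0 r) (T h) = (indicator (ball 0 r) h :: real)" for h
    using T(3)[of h] by (simp add: indicator_def)
  have meas: "(\<lambda>h. indicator (ball 0 r) h *\<^sub>R f h) \<in> borel_measurable borel"
    by (intro borel_measurable_scaleR borel_measurable_indicator f) simp
  have "(LINT h:ball 0 r|lborel. f h)
      = integral\<^sup>L (distr lborel borel T) (\<lambda>h. indicator (ball 0 r) h *\<^sub>R f h)"
    by (simp add: set_lebesgue_integral_def T(1))
  also have "\<dots> = (LINT h|lborel. indicator (ball 0 r) (T h) *\<^sub>R f (T h))"
    using T(2) meas by (intro integral_distr) auto
  finally show ?thesis
    by (simp add: set_lebesgue_integral_def ind)
qed

lemma lborel_distr_reflection:
  fixes j :: "'a::euclidean_space"
  assumes j: "j \<in> Basis"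
  shows "distr lborel borel (\<lambda>x. x - (2 * (x \<bullet> j)) *\<^sub>R j) = lborel"
proof -
  \<comment> \<open>The reflection is a diagonal map whose scaling factors \<open>c b\<close> have
    absolute value one, so its density factor is 1.\<close>
  define c where "c b = (if b = j then -1 else 1 :: real)" for b :: 'a
  have T: "0 + (\<Sum>b\<in>Basis. (c b * (x \<bullet> b)) *\<^sub>R b) = x - (2 * (x \<bullet> j)) *\<^sub>R j" for x
    by (rule euclidean_eqI)
      (use j in \<open>auto simp: c_def inner_diff_left inner_Basis\<close>)
  have "(\<Prod>b\<in>Basis. \<bar>c b\<bar>) = 1"
    by (intro prod.neutral) (auto simp: c_def)
  with lborel_affine_euclidean[of c 0] show ?thesis
    unfolding T by (simp add: c_def density_1)
qed

text \<open>Lebesgue measure is determined by its values on boxes. As the transposition is an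
  involution, the preimage of a box under \<open>T\<close> is the box with two sides exchanged, and
  the product of the side lengths does not change.\<close>

lemma lborel_distr_swap:
  fixes i j :: "'a::euclidean_space"
  assumes ij: "i \<in> Basis" "j \<in> Basis"
  defines "T \<equiv> \<lambda>x. \<Sum>b\<in>Basis. (x \<bullet> Transposition.transpose i j b) *\<^sub>R b"
  shows "distr lborel borel T = lborel"
proof (rule lborel_eqI[symmetric])
  let ?s = "Transposition.transpose i j"
  have sB: "?s b \<in> Basis \<longleftrightarrow> b \<in> Basis" for b
    using ij by (auto simp: Transposition.transpose_def)
  have Tb: "T x \<bullet> b = x \<bullet> ?s b" if "b \<in> Basis" for x b
    using that by (simp add: T_def)
  fix l u :: 'a assume lu: "\<And>b. b \<in> Basis \<Longrightarrow> l \<bullet> b \<le> u \<bullet> b"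
  have [measurable]: "T \<in> borel_measurable borel"
    unfolding T_def by (intro borel_measurable_continuous_onI continuous_intros)
  have vim: "T -` box l u = box (T l) (T u)"
  proof -
    have "(\<forall>b\<in>Basis. l \<bullet> b < T x \<bullet> b \<and> T x \<bullet> b < u \<bullet> b)
        \<longleftrightarrow> (\<forall>b\<in>Basis. T l \<bullet> b < x \<bullet> b \<and> x \<bullet> b < T u \<bullet> b)" for x
      by (auto simp: Tb) (metis sB transpose_involutory Tb)+
    then show ?thesis by (auto simp: box_def)
  qed
  have "emeasure (distr lborel borel T) (box l u) = emeasure lborel (box (T l) (T u))"
    by (simp add: emeasure_distr vim)
  also have "\<dots> = (\<Prod>b\<in>Basis. ennreal ((T u - T l) \<bullet> b))"
    using lu by (subst emeasure_lborel_box) (auto simp: Tb sB prod_ennreal inner_diff_left)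
  also have "\<dots> = (\<Prod>b\<in>Basis. ennreal ((u - l) \<bullet> ?s b))"
    by (intro prod.cong) (auto simp: Tb inner_diff_left)
  also have "\<dots> = (\<Prod>b\<in>Basis. ennreal ((u - l) \<bullet> b))"
    by (rule prod.reindex_bij_witness[of _ ?s ?s]) (auto simp: sB)
  finally show "emeasure (distr lborel borel T) (box l u) = ennreal (\<Prod>b\<in>Basis. (u - l) \<bullet> b)"
    using lu by (simp add: prod_ennreal inner_diff_left)
qed simp

text \<open>The reflection in coordinate \<open>j\<close> preserves the integral, while oddness
  turns it into its negative.\<close>

lemma ball_integral_odd:
  fixes f :: "'a::euclidean_space \<Rightarrow> real"
  assumes j: "j \<in> Basis" and f: "f \<in> borel_measurable borel"
    and odd: "\<And>h. f (h - (2 * (h \<bullet> j)) *\<^sub>R j) = - f h"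
  shows "(LINT h:ball 0 r|lborel. f h) = 0"
proof -
  have "norm (h - (2 * (h \<bullet> j)) *\<^sub>R j) = norm h" for h
    using j unfolding norm_eq
    by (simp add: inner_diff_left inner_diff_right inner_commute algebra_simps)
  then have "(LINT h:ball 0 r|lborel. f (h - (2 * (h \<bullet> j)) *\<^sub>R j)) = (LINT h:ball 0 r|lborel. f h)"
    by (intro set_integral_ball_isometry lborel_distr_reflection j f)
      (auto intro!: borel_measurable_continuous_onI continuous_intros)
  then show ?thesis by (simp add: odd set_lebesgue_integral_def)
qed

lemma ball_integral_scale:
  fixes f :: "'a::euclidean_space \<Rightarrow> real"
  assumes r: "r > 0" and f: "f \<in> borel_measurable borel"
  shows "(LINT h:ball 0 r|lborel. f h) = r ^ DIM('a) * (LINT h:ball 0 1|lborel. f (r *\<^sub>R h))"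
proof -
  have ind: "indicator (ball 0 r) (r *\<^sub>R h) = (indicator (ball 0 1) h :: real)" for h :: 'a
    using r by (auto simp: indicator_def)
  have meas: "(\<lambda>h. indicator (ball 0 r) h *\<^sub>R f h) \<in> borel_measurable borel"
    by (intro borel_measurable_scaleR borel_measurable_indicator f) simp
  have "(LINT h:ball 0 r|lborel. f h)
     = integral\<^sup>L (density (distr lborel borel (\<lambda>x. 0 + r *\<^sub>R x)) (\<lambda>_. \<bar>r\<bar> ^ DIM('a)))
        (\<lambda>h. indicator (ball 0 r) h *\<^sub>R f h)"
    using lborel_affine[of r "0::'a"] r by (simp add: set_lebesgue_integral_def)
  also have "\<dots> = integral\<^sup>L (distr lborel borel (\<lambda>x. 0 + r *\<^sub>R x))
        (\<lambda>h. \<bar>r\<bar> ^ DIM('a) *\<^sub>R (indicator (ball 0 r) h *\<^sub>R f h))"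
    using meas by (intro integral_density) auto
  also have "\<dots> = (LINT h|lborel. \<bar>r\<bar> ^ DIM('a) *\<^sub>R (indicator (ball 0 r) (0 + r *\<^sub>R h) *\<^sub>R f (0 + r *\<^sub>R h)))"
    using meas by (intro integral_distr) auto
  finally show ?thesis using r by (simp add: set_lebesgue_integral_def ind)
qed

text \<open>A substitute for polar coordinates. Scaling reduces everything to the unknown
  \<open>F 1\<close>. On the shell between radii \<open>s\<close> and 1 the integrand lies between
  \<open>s\<^sup>2\<close> and 1, so comparing with the volume of the shell and letting
  \<open>s\<close> tend to 1 yields \<open>F 1 * (d + 2) = V * d\<close>.\<close>

lemma ball_integral_norm_squared:
  assumes r: "r > 0"
  shows "(LINT h:ball (0::'a::euclidean_space) r|lborel. (norm h)\<^sup>2)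
    = measure lborel (ball (0::'a) r) * (r\<^sup>2 * DIM('a) / (DIM('a) + 2))"
proof -
  define d where "d = DIM('a)"
  define V where "V = measure lborel (ball (0::'a) 1)"
  define F where "F r = (LINT h:ball (0::'a) r|lborel. (norm h)\<^sup>2)" for r
  have d: "d > 0" by (simp add: d_def)
  have F: "F r = r ^ (d + 2) * F 1" if "r > 0" for r
  proof -
    have "F r = r ^ d * (LINT h:ball 0 1|lborel. r\<^sup>2 * (norm (h::'a))\<^sup>2)"
      unfolding F_def d_def using ball_integral_scale[OF that, of "\<lambda>h::'a. (norm h)\<^sup>2"]
      by (simp add: power_mult_distrib)
    then show ?thesis by (simp add: F_def power_add power2_eq_square)
  qed
  have V: "measure lborel (ball (0::'a) r) = r ^ d * V" if "r \<ge> 0" for r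
    unfolding V_def d_def using that by (rule content_ball_conv_unit_ball)
  have bnd: "s\<^sup>2 * (V * (1 - s ^ d)) \<le> F 1 * (1 - s ^ (d + 2)) \<and> F 1 * (1 - s ^ (d + 2)) \<le> V * (1 - s ^ d)"
    if s: "0 < s" "s < 1" for s
  proof -
    let ?A = "ball (0::'a) 1 - ball 0 s"
    have sub: "ball (0::'a) s \<subseteq> ball 0 1" using s by auto
    have [simp]: "set_integrable lborel (ball (0::'a) t) (\<lambda>h. (norm h)\<^sup>2)" for t
      by (intro set_integrable_ball_continuous continuous_intros)
    have iA: "set_integrable lborel ?A (\<lambda>h. (norm h)\<^sup>2)"
      by (rule set_integrable_subset[of _ "ball (0::'a) 1"]) auto
    have "?A \<union> ball 0 s = ball 0 1" using sub by auto
    then have "F 1 = (LINT h:?A|lborel. (norm h)\<^sup>2) + F s"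
      unfolding F_def using set_integral_Un[of ?A "ball 0 s" lborel "\<lambda>h. (norm h)\<^sup>2"] iA by auto
    then have eq: "(LINT h:?A|lborel. (norm h)\<^sup>2) = F 1 * (1 - s ^ (d + 2))"
      using F[OF s(1)] by (simp add: algebra_simps)
    have mA: "measure lborel ?A = V * (1 - s ^ d)"
      using measure_Diff[of lborel "ball (0::'a) 1" "ball 0 s"] sub
        emeasure_lborel_ball_finite[of "0::'a" 1] V[of s] V[of 1] s
      by (simp add: algebra_simps less_top)
    have fA: "emeasure lborel ?A < \<infinity>"
      by (rule le_less_trans[OF emeasure_mono emeasure_lborel_ball_finite[of "0::'a" 1]]) auto
    have ci: "set_integrable lborel ?A (\<lambda>h. k)" for k :: real
      using fA by (simp add: set_integrable_def less_top)
    have cc: "(LINT h:?A|lborel. k) = k * (V * (1 - s ^ d))" for k :: real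
      using fA mA by (simp add: set_lebesgue_integral_def mult.commute)
    have "(LINT h:?A|lborel. s\<^sup>2) \<le> (LINT h:?A|lborel. (norm h)\<^sup>2)"
      using s by (intro set_integral_mono ci iA) (auto intro!: power_mono)
    moreover have "(LINT h:?A|lborel. (norm h)\<^sup>2) \<le> (LINT h:?A|lborel. 1)"
      using s by (intro set_integral_mono ci iA) (auto intro!: power_le_one)
    ultimately show ?thesis unfolding cc eq by simp
  qed
  have geo: "(1 - s ^ n) / (1 - s) = (\<Sum>k<n. s ^ k)" if "s \<noteq> 1" for s :: real and n
    using that by (simp add: sum_gp_strict)
  \<comment> \<open>Division of the shell bounds by \<open>1 - s\<close> turns the differences of
    powers into geometric sums of \<open>d\<close> and \<open>d + 2\<close> terms, each of which
    tends to 1.\<close>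
  have "F 1 * (d + 2) = V * d"
  proof (rule antisym)
    have ev: "\<forall>\<^sub>F s in at_left (1::real). s \<in> {0<..<1}"
      by (rule eventually_at_leftI[of 0]) auto
    have lim: "((\<lambda>s. K * (\<Sum>k<n. s ^ k)) \<longlongrightarrow> K * n) (at_left (1::real))" for K n
      by (auto intro!: tendsto_eq_intros)
    have lim2: "((\<lambda>s. s\<^sup>2 * (V * (\<Sum>k<n. s ^ k))) \<longlongrightarrow> V * n) (at_left (1::real))" for n
      by (auto intro!: tendsto_eq_intros)
    have g: "s\<^sup>2 * (V * (\<Sum>k<d. s ^ k)) \<le> F 1 * (\<Sum>k<d+2. s ^ k) \<and>
        F 1 * (\<Sum>k<d+2. s ^ k) \<le> V * (\<Sum>k<d. s ^ k)" if "s \<in> {0<..<1}" for s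
    proof -
      from that have s: "0 < s" "s < 1" by auto
      have "1 - s ^ n = (1 - s) * (\<Sum>k<n. s ^ k)" for n
        using geo[of s n] s by (simp add: field_simps)
      note bnd[OF s, unfolded this]
      then have "(1 - s) * (s\<^sup>2 * (V * (\<Sum>k<d. s ^ k))) \<le> (1 - s) * (F 1 * (\<Sum>k<d+2. s ^ k))"
        "(1 - s) * (F 1 * (\<Sum>k<d+2. s ^ k)) \<le> (1 - s) * (V * (\<Sum>k<d. s ^ k))"
        by (simp_all only: mult_ac)
      then show ?thesis using s by (simp only: mult_le_cancel_left_pos)
    qed
    show "F 1 * (d + 2) \<le> V * d"
      using tendsto_le[OF _ lim[of V d] lim[of "F 1" "d + 2"]] eventually_mono[OF ev g] 
      by (simp add: eventually_conj_iff)
    show "V * d \<le> F 1 * (d + 2)"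
      using tendsto_le[OF _ lim[of "F 1" "d + 2"] lim2[of d]] eventually_mono[OF ev g] 
      by (simp add: eventually_conj_iff)
  qed
  then have "F 1 = V * d / (d + 2)" by (simp add: field_simps)
  moreover have "F r = r ^ (d + 2) * F 1" "measure lborel (ball (0::'a) r) = r ^ d * V"
    using F[OF r] V[of r] r by auto
  ultimately show ?thesis unfolding F_def d_def by (simp add: power_add power2_eq_square)
qed

text \<open>Off the diagonal the integrand is odd in coordinate \<open>j\<close>. On the diagonal,
  swapping coordinates shows that all \<open>DIM('a)\<close> integrals agree, and they add up to the
  integral of the squared norm.\<close>

lemma ball_integral_coordinate_products:
  fixes i j :: "'a::euclidean_space"
  assumes r: "r > 0" and i: "i \<in> Basis" and j: "j \<in> Basis"
  shows "(LINT h:ball 0 r|lborel. (h \<bullet> i) * (h \<bullet> j))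
    = (if i = j then measure lborel (ball (0::'a) r) * (r\<^sup>2 / (DIM('a) + 2)) else 0)"
proof (cases "i = j")
  case False
  have "(LINT h:ball 0 r|lborel. (h \<bullet> i) * (h \<bullet> j)) = 0"
    using False i j by (intro ball_integral_odd[of j])
      (auto simp: inner_diff_left inner_diff_right inner_Basis algebra_simps)
  then show ?thesis using False by simp
next
  case True
  have eq: "(LINT h:ball 0 r|lborel. (h \<bullet> b)\<^sup>2) = (LINT h:ball 0 r|lborel. (h \<bullet> i)\<^sup>2)"
    if b: "b \<in> Basis" for b :: 'a
  proof -
    let ?s = "Transposition.transpose i b"
    define T where "T \<equiv> \<lambda>x::'a. \<Sum>c\<in>Basis. (x \<bullet> ?s c) *\<^sub>R c"
    have Tb: "T x \<bullet> c = x \<bullet> ?s c" if "c \<in> Basis" for x c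
      using that by (simp add: T_def)
    have sB: "?s c \<in> Basis \<longleftrightarrow> c \<in> Basis" for c
      using i b by (auto simp: Transposition.transpose_def)
    have "T x \<bullet> T x = x \<bullet> x" for x
    proof -
      have "T x \<bullet> T x = (\<Sum>c\<in>Basis. (x \<bullet> ?s c) * (x \<bullet> ?s c))"
        by (subst euclidean_inner) (auto simp: Tb intro!: sum.cong)
      also have "\<dots> = (\<Sum>c\<in>Basis. (x \<bullet> c) * (x \<bullet> c))"
        by (rule sum.reindex_bij_witness[of _ ?s ?s]) (auto simp: sB)
      finally show ?thesis by (simp add: euclidean_inner[symmetric])
    qed
    then have nT: "norm (T x) = norm x" for x by (simp add: norm_eq)
    have TM: "T \<in> borel_measurable borel"
      unfolding T_def by (intro borel_measurable_continuous_onI continuous_intros)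
    have "distr lborel borel T = lborel"
      unfolding T_def using i b by (rule lborel_distr_swap)
    then have "(LINT h:ball 0 r|lborel. (T h \<bullet> i)\<^sup>2) = (LINT h:ball 0 r|lborel. (h \<bullet> i)\<^sup>2)"
      by (rule set_integral_ball_isometry) (use nT TM in auto)
    then show ?thesis by (simp add: Tb i)
  qed
  have sq: "(norm h)\<^sup>2 = (\<Sum>b\<in>Basis. (h \<bullet> b)\<^sup>2)" for h :: 'a
    unfolding power2_norm_eq_inner by (subst euclidean_inner) (simp add: power2_eq_square)
  have "measure lborel (ball (0::'a) r) * (r\<^sup>2 * DIM('a) / (DIM('a) + 2))
      = (LINT h:ball (0::'a) r|lborel. \<Sum>b\<in>Basis. (h \<bullet> b)\<^sup>2)"
    by (simp only: ball_integral_norm_squared[OF r, symmetric] sq)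
  also have "\<dots> = (\<Sum>b\<in>Basis. (LINT h:ball (0::'a) r|lborel. (h \<bullet> b)\<^sup>2))"
    unfolding set_lebesgue_integral_def scaleR_sum_right
    by (intro Bochner_Integration.integral_sum
          set_integrable_ball_continuous[unfolded set_integrable_def] continuous_intros)
  also have "\<dots> = DIM('a) * (LINT h:ball 0 r|lborel. (h \<bullet> i)\<^sup>2)"
    by (simp add: eq)
  finally have "DIM('a) * (LINT h:ball 0 r|lborel. (h \<bullet> i)\<^sup>2)
      = DIM('a) * (measure lborel (ball (0::'a) r) * (r\<^sup>2 / (DIM('a) + 2)))"
    by (simp add: mult_ac)
  then have "(LINT h:ball 0 r|lborel. (h \<bullet> i)\<^sup>2) = measure lborel (ball (0::'a) r) * (r\<^sup>2 / (DIM('a) + 2))"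
    by (simp only: mult_cancel_left) simp
  then show ?thesis using True by (simp add: power2_eq_square)
qed

section \<open>Second-order expansions of suprema and averages over balls\<close>

lemma second_order_taylor:
  fixes f :: "'a::euclidean_space \<Rightarrow> real"
  assumes R: "R > 0"
    and f': "\<And>y. y \<in> ball x R \<Longrightarrow> (f has_derivative (\<lambda>h. G y \<bullet> h)) (at y)"
    and G': "(G has_derivative H) (at x)" and \<eta>: "\<eta> > 0"
  shows "\<exists>\<delta>>0. \<forall>h. norm h < \<delta> \<longrightarrow>
    \<bar>f (x + h) - f x - G x \<bullet> h - (H h \<bullet> h) / 2\<bar> \<le> \<eta> * (norm h)\<^sup>2"
proof -
  from G' \<eta> obtain \<delta> where \<delta>: "\<delta> > 0"
    and G\<delta>: "\<And>y. norm (y - x) < \<delta> \<Longrightarrow> norm (G y - G x - H (y - x)) \<le> \<eta> * norm (y - x)"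
    unfolding has_derivative_at_alt by blast
  have lin: "linear H" using G' by (rule has_derivative_linear)
  have "\<bar>f (x + h) - f x - G x \<bullet> h - (H h \<bullet> h) / 2\<bar> \<le> \<eta> * (norm h)\<^sup>2" if h: "norm h < min \<delta> R" for h
  proof -
    \<comment> \<open>\<open>\<psi> 1 - \<psi> 0\<close> is the Taylor remainder, and
      \<open>\<psi>'\<close> is the first-order error of \<open>G\<close> at \<open>x\<close> paired
      with \<open>h\<close>. One mean value step therefore suffices, with \<open>G\<close>
      differentiated at \<open>x\<close> alone.\<close>
    define \<psi> where "\<psi> s = f (x + s *\<^sub>R h) - s * (G x \<bullet> h) - s\<^sup>2 * (H h \<bullet> h) / 2" for s
    define \<psi>' where "\<psi>' s = (G (x + s *\<^sub>R h) - G x - H (s *\<^sub>R h)) \<bullet> h" for s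
    have sh: "norm (s *\<^sub>R h) \<le> norm h" if "0 \<le> s" "s \<le> 1" for s
      using that by (simp add: mult_left_le_one_le)
    have "(\<psi> has_real_derivative \<psi>' s) (at s)" if s: "0 \<le> s" "s \<le> 1" for s
    proof -
      have "x + s *\<^sub>R h \<in> ball x R" using sh[OF s] h by (simp add: dist_norm)
      note f'[OF this]
      moreover have "((\<lambda>s. x + s *\<^sub>R h) has_derivative (\<lambda>t. t *\<^sub>R h)) (at s)"
        by (auto intro!: derivative_eq_intros)
      ultimately
      have "((\<lambda>s. f (x + s *\<^sub>R h)) has_derivative (\<lambda>t. G (x + s *\<^sub>R h) \<bullet> (t *\<^sub>R h))) (at s)"
        by (rule has_derivative_compose[rotated])
      then have "((\<lambda>s. f (x + s *\<^sub>R h)) has_real_derivative G (x + s *\<^sub>R h) \<bullet> h) (at s)"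
        by (rule has_derivative_imp_has_field_derivative) simp
      then show ?thesis unfolding \<psi>_def \<psi>'_def
        by (auto intro!: derivative_eq_intros simp: inner_diff_left linear_cmul[OF lin])
    qed
    from MVT2[of 0 1 \<psi> \<psi>', OF _ this] obtain z where z: "0 < z" "z < 1" "\<psi> 1 - \<psi> 0 = \<psi>' z"
      by auto
    have "norm (G (x + z *\<^sub>R h) - G x - H (z *\<^sub>R h)) \<le> \<eta> * norm (z *\<^sub>R h)"
      using G\<delta>[of "x + z *\<^sub>R h"] sh[of z] z h by simp
    also have "\<dots> \<le> \<eta> * norm h"
      using sh[of z] z \<eta> by (intro mult_left_mono) auto
    finally have "\<bar>\<psi>' z\<bar> \<le> \<eta> * norm h * norm h"
      unfolding \<psi>'_def by (intro order_trans[OF Cauchy_Schwarz_ineq2] mult_right_mono) auto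
    with z show ?thesis by (simp add: \<psi>_def power2_eq_square algebra_simps)
  qed
  with \<delta> R show ?thesis by (intro exI[of _ "min \<delta> R"]) auto
qed

section \<open>Suprema over small balls\<close>

lemma inner_sgn_self: "g \<bullet> sgn g = norm (g :: 'a::real_inner)"
  by (cases "g = 0") (simp_all add: sgn_div_norm dot_square_norm power2_eq_square)

text \<open>The balls are open, so the natural competitor \<open>x + r *\<^sub>R n\<close> may lie
  outside. It is approached from inside along the ray, and the bound passes to the limit by
  continuity of \<open>F\<close>.\<close>

lemma le_SUP_ball_limit:
  fixes f :: "'a::real_normed_vector \<Rightarrow> real"
  assumes r: "r > 0" and n: "norm n \<le> 1" and bdd: "bdd_above (f ` ball x r)"
    and F: "\<And>s. 0 < s \<Longrightarrow> s < r \<Longrightarrow> F s \<le> f (x + s *\<^sub>R n)" and cont: "isCont F r"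
  shows "F r \<le> (SUP y\<in>ball x r. f y)"
proof -
  have "F s \<le> (SUP y\<in>ball x r. f y)" if s: "s \<in> {0<..<r}" for s
  proof -
    have "s * norm n \<le> s" using s n by (simp add: mult_left_le)
    also have "s < r" using s by simp
    finally have "x + s *\<^sub>R n \<in> ball x r" using s by (simp add: dist_norm)
    with F[of s] s bdd show ?thesis by (auto intro: cSUP_upper2)
  qed
  moreover have "\<forall>\<^sub>F s in at_left r. s \<in> {0<..<r}"
    using r by (intro eventually_at_leftI[of 0]) auto
  ultimately have "\<forall>\<^sub>F s in at_left r. F s \<le> (SUP y\<in>ball x r. f y)"
    by (auto elim: eventually_mono)
  moreover have "(F \<longlongrightarrow> F r) (at_left r)"
    using cont by (simp add: isCont_def filterlim_at_split)
  ultimately show ?thesis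
    by (intro tendsto_upperbound) auto
qed

text \<open>Cauchy-Schwarz gives the upper bound, the ray in direction \<open>sgn g\<close> the
  lower one. Because \<open>sgn 0 = 0\<close>, critical points are covered. The second part
  guarantees that \<open>SUP\<close> is a genuine supremum.\<close>

lemma SUP_ball_first_order:
  fixes f :: "'a::real_inner \<Rightarrow> real"
  assumes r: "0 < r" "r \<le> \<delta>" and K: "K \<ge> 0"
    and T: "\<And>h. norm h < \<delta> \<Longrightarrow> \<bar>f (x + h) - f x - g \<bullet> h\<bar> \<le> K * (norm h)\<^sup>2"
  shows "\<bar>(SUP y\<in>ball x r. f y) - f x - r * norm g\<bar> \<le> K * r\<^sup>2" (is ?A)
    and "bdd_above (f ` ball x r)" (is ?B)
proof -
  have up: "f y \<le> f x + r * norm g + K * r\<^sup>2" if "y \<in> ball x r" for y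
  proof -
    define h where "h = y - x"
    have h: "norm h < r" "y = x + h" using that by (auto simp: h_def dist_norm norm_minus_commute)
    have "g \<bullet> h \<le> norm g * r"
      using h by (intro order_trans[OF norm_cauchy_schwarz] mult_left_mono) auto
    moreover have "K * (norm h)\<^sup>2 \<le> K * r\<^sup>2"
      using h K by (intro mult_left_mono power_mono) auto
    ultimately show ?thesis using T[of h] h r by (simp add: mult.commute)
  qed
  then show B: ?B by (intro bdd_aboveI2)
  have "(SUP y\<in>ball x r. f y) \<le> f x + r * norm g + K * r\<^sup>2"
    using up r by (intro cSUP_least) auto
  moreover have "f x + r * norm g - K * r\<^sup>2 \<le> (SUP y\<in>ball x r. f y)"
  proof (rule le_SUP_ball_limit[of r "sgn g" f x "\<lambda>s. f x + s * norm g - K * s\<^sup>2"])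
    fix s assume s: "0 < s" "s < r"
    have n: "norm (s *\<^sub>R sgn g) \<le> s" using s by (simp add: norm_sgn)
    then have "K * (norm (s *\<^sub>R sgn g))\<^sup>2 \<le> K * s\<^sup>2"
      using K s by (intro mult_left_mono power_mono) auto
    moreover have "g \<bullet> (s *\<^sub>R sgn g) = s * norm g"
      by (simp add: inner_sgn_self)
    moreover have "norm (s *\<^sub>R sgn g) < \<delta>" using n s r by linarith
    ultimately show "f x + s * norm g - K * s\<^sup>2 \<le> f (x + s *\<^sub>R sgn g)"
      using T[of "s *\<^sub>R sgn g"] unfolding abs_le_iff by linarith
  qed (use r B in \<open>auto simp: norm_sgn intro!: continuous_intros\<close>)
  ultimately show ?A by (simp add: abs_le_iff)
qed

text \<open>A Taylor expansion with Peano remainder at the single point \<open>x\<close>. The limits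
  of the averaging operators are computed from this data, and it is stable under passing to
  \<open>-f\<close>.\<close>

definition second_order_expansion ::
    "('a::real_inner \<Rightarrow> real) \<Rightarrow> 'a \<Rightarrow> 'a \<Rightarrow> ('a \<Rightarrow> 'a) \<Rightarrow> bool" where
  "second_order_expansion f x g H \<longleftrightarrow> bounded_linear H \<and>
    (\<forall>\<eta>>0. \<exists>\<delta>>0. \<forall>h. norm h < \<delta> \<longrightarrow>
      \<bar>f (x + h) - f x - g \<bullet> h - (H h \<bullet> h) / 2\<bar> \<le> \<eta> * (norm h)\<^sup>2)"

lemma second_order_expansion_uminus:
  assumes "second_order_expansion f x g H"
  shows "second_order_expansion (\<lambda>y. - f y) x (- g) (\<lambda>h. - H h)"
proof -
  have "\<bar>- a - - b - (- g) \<bullet> h - (- H h \<bullet> h) / 2\<bar> = \<bar>a - b - g \<bullet> h - (H h \<bullet> h) / 2\<bar>" for a b h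
    by (simp add: abs_if)
  with assms show ?thesis
    unfolding second_order_expansion_def by (simp add: bounded_linear_minus)
qed

text \<open>As \<open>H\<close> is bounded, the Hessian term is itself at most a multiple of
  \<open>(norm h)\<^sup>2\<close> and is absorbed into \<open>K\<close>. The estimate makes no
  distinction between critical and noncritical points.\<close>

lemma second_order_expansion_first_order:
  assumes "second_order_expansion f x g H"
  shows "\<exists>K>0. \<exists>\<delta>>0. \<forall>h. norm h < \<delta> \<longrightarrow> \<bar>f (x + h) - f x - g \<bullet> h\<bar> \<le> K * (norm h)\<^sup>2"
proof -
  from assms have "bounded_linear H" unfolding second_order_expansion_def by simp
  then obtain C where C: "C > 0" "\<And>h. norm (H h) \<le> norm h * C"
    using bounded_linear.pos_bounded by blast
  from assms obtain \<delta> where \<delta>: "\<delta> > 0"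
    "\<And>h. norm h < \<delta> \<Longrightarrow> \<bar>f (x + h) - f x - g \<bullet> h - (H h \<bullet> h) / 2\<bar> \<le> 1 * (norm h)\<^sup>2"
    unfolding second_order_expansion_def using zero_less_one by blast
  have "\<bar>f (x + h) - f x - g \<bullet> h\<bar> \<le> (1 + C) * (norm h)\<^sup>2" if "norm h < \<delta>" for h
  proof -
    have "\<bar>H h \<bullet> h\<bar> \<le> norm h * C * norm h"
      by (intro order_trans[OF Cauchy_Schwarz_ineq2] mult_right_mono C) simp
    moreover have "0 \<le> C * (norm h)\<^sup>2" using C by simp
    ultimately have "\<bar>(H h \<bullet> h) / 2\<bar> \<le> C * (norm h)\<^sup>2"
      by (simp add: power2_eq_square mult_ac)
    with \<delta>(2)[OF that] show ?thesis by (simp add: algebra_simps)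
  qed
  with C \<delta> show ?thesis by (intro exI[of _ "1 + C"]) auto
qed

text \<open>
  The maximum over the sphere is attained within \<open>O(r\<^sup>2)\<close> of \<open>r n\<close>: moving a distance \<open>w\<close>
  away from \<open>r n\<close> loses \<open>\<bar>g\<bar> w\<^sup>2 / (2 r)\<close> in the linear term and gains at most \<open>C r w\<close> in the
  quadratic one.
\<close>

lemma linear_plus_quadratic_le:
  fixes g h :: "'a::real_inner"
  assumes r: "r > 0" and h: "norm h \<le> r" and g: "g \<noteq> 0" and H: "bounded_linear H"
    and C: "C > 0" "\<And>h. norm (H h) \<le> norm h * C"
  defines "n \<equiv> sgn g"
  shows "g \<bullet> h + (H h \<bullet> h) / 2 \<le> r * norm g + r\<^sup>2 * (H n \<bullet> n) / 2 + C\<^sup>2 * r ^ 3 / (2 * norm g)"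
proof -
  define w where "w = norm (h - r *\<^sub>R n)"
  define a where "a = norm g"
  have a: "a > 0" using g by (simp add: a_def)
  have nn: "norm n = 1" using g by (simp add: n_def norm_sgn)
  have gn: "g = a *\<^sub>R n" using g by (simp add: a_def n_def sgn_div_norm)
  have "w\<^sup>2 = (norm h)\<^sup>2 - 2 * r * (n \<bullet> h) + r\<^sup>2"
    unfolding w_def power2_norm_eq_inner using nn
    by (simp add: inner_diff_left inner_diff_right inner_commute norm_eq_1 power2_eq_square algebra_simps)
  moreover have "(norm h)\<^sup>2 \<le> r\<^sup>2" using h by (intro power_mono) auto
  ultimately have "2 * r * (n \<bullet> h) \<le> 2 * r\<^sup>2 - w\<^sup>2" by simp
  then have "n \<bullet> h \<le> r - w\<^sup>2 / (2 * r)" using r by (simp add: field_simps power2_eq_square)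
  then have "a * (n \<bullet> h) \<le> a * (r - w\<^sup>2 / (2 * r))" using a by (intro mult_left_mono) auto
  then have 1: "g \<bullet> h \<le> r * a - a * w\<^sup>2 / (2 * r)" by (simp add: gn algebra_simps)
  have "H h \<bullet> h - H (r *\<^sub>R n) \<bullet> (r *\<^sub>R n) = H (h - r *\<^sub>R n) \<bullet> h + H (r *\<^sub>R n) \<bullet> (h - r *\<^sub>R n)"
    by (simp add: linear_diff[OF bounded_linear.linear[OF H]] inner_diff_left inner_diff_right)
  also have "\<dots> \<le> (w * C) * r + (r * C) * w"
  proof (rule add_mono)
    have "norm (H (h - r *\<^sub>R n)) * norm h \<le> (w * C) * r"
      using C(2)[of "h - r *\<^sub>R n"] C(1) h by (intro mult_mono) (auto simp: w_def)
    then show "H (h - r *\<^sub>R n) \<bullet> h \<le> (w * C) * r"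
      by (rule order_trans[OF norm_cauchy_schwarz])
    have "norm (H (r *\<^sub>R n)) * norm (h - r *\<^sub>R n) \<le> (r * C) * w"
      using C(2)[of "r *\<^sub>R n"] C(1) r nn by (intro mult_mono) (auto simp: w_def)
    then show "H (r *\<^sub>R n) \<bullet> (h - r *\<^sub>R n) \<le> (r * C) * w"
      by (rule order_trans[OF norm_cauchy_schwarz])
  qed
  also have "H (r *\<^sub>R n) \<bullet> (r *\<^sub>R n) = r\<^sup>2 * (H n \<bullet> n)"
    by (simp add: linear_cmul[OF bounded_linear.linear[OF H]] power2_eq_square)
  finally have 2: "(H h \<bullet> h) / 2 \<le> r\<^sup>2 * (H n \<bullet> n) / 2 + C * r * w" by (simp add: algebra_simps)
  \<comment> \<open>Completing the square shows that the possible gain \<open>C * r * w\<close>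
    exceeds the loss \<open>a * w\<^sup>2 / (2 * r)\<close> by at most a cubic term, whatever
    \<open>w\<close> is.\<close>
  have "0 \<le> (a * w - C * r\<^sup>2)\<^sup>2 / (2 * a * r)" using a r by simp
  also have "\<dots> = a * w\<^sup>2 / (2 * r) - C * r * w + C\<^sup>2 * r ^ 3 / (2 * a)"
    using a r by (simp add: field_simps power2_eq_square power3_eq_cube)
  finally show ?thesis using 1 2 by (simp add: a_def)
qed

lemma SUP_ball_second_order:
  fixes f :: "'a::real_inner \<Rightarrow> real"
  assumes exp: "second_order_expansion f x g H" and g: "g \<noteq> 0" and \<eta>: "\<eta> > 0"
  shows "\<exists>\<delta>>0. \<forall>r. 0 < r \<and> r < \<delta> \<longrightarrow>
    \<bar>(SUP y\<in>ball x r. f y) - f x - r * norm g - r\<^sup>2 * (H (sgn g) \<bullet> sgn g) / 2\<bar> \<le> \<eta> * r\<^sup>2"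
proof -
  from exp have H: "bounded_linear H" unfolding second_order_expansion_def by simp
  then obtain C where C: "C > 0" "\<And>h. norm (H h) \<le> norm h * C"
    using bounded_linear.pos_bounded by blast
  have "\<eta> / 2 > 0" using \<eta> by simp
  with exp obtain \<delta>1 where \<delta>1: "\<delta>1 > 0" and T:
    "\<And>h. norm h < \<delta>1 \<Longrightarrow> \<bar>f (x + h) - f x - g \<bullet> h - (H h \<bullet> h) / 2\<bar> \<le> \<eta> / 2 * (norm h)\<^sup>2"
    unfolding second_order_expansion_def by blast
  from second_order_expansion_first_order[OF exp] obtain K \<delta>2 where K: "K > 0" "\<delta>2 > 0" 
    and T1: "\<And>h. norm h < \<delta>2 \<Longrightarrow> \<bar>f (x + h) - f x - g \<bullet> h\<bar> \<le> K * (norm h)\<^sup>2"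
    by blast
  \<comment> \<open>The last entry makes the cubic error of \<open>linear_plus_quadratic_le\<close>
    at most half of \<open>\<eta> * r\<^sup>2\<close>; the Taylor remainder takes the other
    half.\<close>
  define \<delta> where "\<delta> = min (min \<delta>1 \<delta>2) (\<eta> * norm g / C\<^sup>2)"
  have "\<delta> > 0" using \<delta>1 K g \<eta> C by (simp add: \<delta>_def)
  moreover have "\<bar>(SUP y\<in>ball x r. f y) - f x - r * norm g - r\<^sup>2 * (H (sgn g) \<bullet> sgn g) / 2\<bar> \<le> \<eta> * r\<^sup>2"
    if r: "0 < r" "r < \<delta>" for r
  proof -
    let ?q = "(H (sgn g) \<bullet> sgn g) / 2"
    have r1: "r < \<delta>1" "r < \<delta>2" "r < \<eta> * norm g / C\<^sup>2" using r by (auto simp: \<delta>_def)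
    have "C\<^sup>2 * r \<le> \<eta> * norm g" using r1(3) C by (simp add: field_simps)
    then have "C\<^sup>2 * r * r\<^sup>2 / (2 * norm g) \<le> \<eta> * norm g * r\<^sup>2 / (2 * norm g)"
      by (intro divide_right_mono mult_right_mono) auto
    then have err: "C\<^sup>2 * r ^ 3 / (2 * norm g) \<le> \<eta> / 2 * r\<^sup>2"
      using g by (simp add: power3_eq_cube power2_eq_square mult_ac)
    have B: "bdd_above (f ` ball x r)"
      by (rule SUP_ball_first_order(2)[of r \<delta>2 K]) (use r r1 K T1 in auto)
    have "f y \<le> f x + r * norm g + r\<^sup>2 * ?q + \<eta> * r\<^sup>2" if "y \<in> ball x r" for y
    proof -
      define h where "h = y - x"
      have h: "norm h < r" "y = x + h" using that by (auto simp: h_def dist_norm norm_minus_commute)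
      have "g \<bullet> h + (H h \<bullet> h) / 2 \<le> r * norm g + r\<^sup>2 * (H (sgn g) \<bullet> sgn g) / 2 + C\<^sup>2 * r ^ 3 / (2 * norm g)"
        by (rule linear_plus_quadratic_le) (use r h g H C in auto)
      moreover have "\<eta> / 2 * (norm h)\<^sup>2 \<le> \<eta> / 2 * r\<^sup>2"
        using h \<eta> by (intro mult_left_mono power_mono) auto
      moreover have "\<bar>f y - f x - g \<bullet> h - (H h \<bullet> h) / 2\<bar> \<le> \<eta> / 2 * (norm h)\<^sup>2"
        using T[of h] h r1 by simp
      ultimately show ?thesis using err unfolding abs_le_iff by linarith
    qed
    then have "(SUP y\<in>ball x r. f y) \<le> f x + r * norm g + r\<^sup>2 * ?q + \<eta> * r\<^sup>2"
      using r by (intro cSUP_least) auto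
    moreover have "f x + r * norm g + r\<^sup>2 * ?q - \<eta> * r\<^sup>2 \<le> (SUP y\<in>ball x r. f y)"
    proof (rule le_SUP_ball_limit[of r "sgn g" f x "\<lambda>s. f x + s * norm g + s\<^sup>2 * ?q - \<eta> * s\<^sup>2"])
      fix s assume s: "0 < s" "s < r"
      have n: "norm (s *\<^sub>R sgn g) = s" using s g by (simp add: norm_sgn)
      have "g \<bullet> (s *\<^sub>R sgn g) = s * norm g"
        by (simp add: inner_sgn_self)
      moreover have "H (s *\<^sub>R sgn g) \<bullet> (s *\<^sub>R sgn g) / 2 = s\<^sup>2 * ?q"
        by (simp add: linear_cmul[OF bounded_linear.linear[OF H]] power2_eq_square)
      moreover have "\<eta> / 2 * s\<^sup>2 \<le> \<eta> * s\<^sup>2" using \<eta> by (intro mult_right_mono) auto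
      ultimately show "f x + s * norm g + s\<^sup>2 * ?q - \<eta> * s\<^sup>2 \<le> f (x + s *\<^sub>R sgn g)"
        using T[of "s *\<^sub>R sgn g"] s r1 unfolding n abs_le_iff by linarith
    qed (use r B in \<open>auto simp: norm_sgn intro!: continuous_intros\<close>)
    ultimately show ?thesis by (simp add: abs_le_iff)
  qed
  ultimately show ?thesis by blast
qed

section \<open>Averages over small balls\<close>

lemma ball_integral_shift:
  fixes f :: "'a::euclidean_space \<Rightarrow> real"
  assumes "set_integrable lborel (ball x r) f"
  shows "set_integrable lborel (ball 0 r) (\<lambda>h. f (x + h))"
    and "(LINT y:ball x r|lborel. f y) = (LINT h:ball 0 r|lborel. f (x + h))"
proof -
  let ?F = "\<lambda>y. indicator (ball x r) y *\<^sub>R f y"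
  have ind: "indicator (ball x r) (x + h) = (indicator (ball 0 r) h :: real)" for h
    by (simp add: indicator_def dist_norm)
  have F: "integrable (distr lborel borel ((+) x)) ?F"
    using assms by (simp add: set_integrable_def lborel_distr_plus)
  then have M: "?F \<in> borel_measurable borel"
    by (auto dest: borel_measurable_integrable)
  show "set_integrable lborel (ball 0 r) (\<lambda>h. f (x + h))"
    using F M by (subst (asm) integrable_distr_eq) (auto simp: set_integrable_def ind)
  have "integral\<^sup>L (distr lborel borel ((+) x)) ?F = (LINT h|lborel. ?F (x + h))"
    using M by (intro integral_distr) auto
  then show "(LINT y:ball x r|lborel. f y) = (LINT h:ball 0 r|lborel. f (x + h))"
    by (simp add: set_lebesgue_integral_def lborel_distr_plus ind)
qed

text \<open>The linear part integrates to zero by oddness. In the quadratic part only the diagonal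
  second moments survive, and these are all equal, which leaves the trace of
  \<open>H\<close>.\<close>

lemma ball_average_quadratic:
  fixes g :: "'a::euclidean_space" and H :: "'a \<Rightarrow> 'a" and k :: real
  assumes r: "r > 0" and H: "bounded_linear H"
  defines "q \<equiv> \<lambda>h. k + g \<bullet> h + (H h \<bullet> h) / 2"
  shows "(LINT h:ball 0 r|lborel. q h)
    = measure lborel (ball (0::'a) r) * (k + r\<^sup>2 / (2 * (DIM('a) + 2)) * (\<Sum>b\<in>Basis. H b \<bullet> b))"
proof -
  let ?V = "measure lborel (ball (0::'a) r)" and ?B = "ball (0::'a) r"
  let ?w = "\<lambda>b c h. (h \<bullet> b) * (h \<bullet> c) :: real"
  have int: "set_integrable lborel ?B f" if "continuous_on UNIV f" for f :: "'a \<Rightarrow> real"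
    using that by (intro set_integrable_ball_continuous) (auto intro: continuous_on_subset)
  have w: "set_integrable lborel ?B (?w b c)" for b c
    by (intro int continuous_intros)
  have lin: "linear H" using H by (rule bounded_linear.linear)
  have Hh: "H h \<bullet> h = (\<Sum>b\<in>Basis. \<Sum>c\<in>Basis. (H b \<bullet> c) * ?w b c h)" for h
  proof -
    have "H h = (\<Sum>b\<in>Basis. (h \<bullet> b) *\<^sub>R H b)"
      by (subst euclidean_representation[of h, symmetric]) (simp add: linear_sum[OF lin] linear_cmul[OF lin])
    then have "H h \<bullet> h = (\<Sum>b\<in>Basis. (h \<bullet> b) * (H b \<bullet> h))"
      by (simp add: inner_sum_left)
    also have "\<dots> = (\<Sum>b\<in>Basis. \<Sum>c\<in>Basis. (H b \<bullet> c) * ?w b c h)"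
      by (subst euclidean_inner) (simp add: sum_distrib_left mult_ac)
    finally show ?thesis .
  qed
  have "(LINT h:?B|lborel. H h \<bullet> h) = (\<Sum>b\<in>Basis. \<Sum>c\<in>Basis. (H b \<bullet> c) * (LINT h:?B|lborel. ?w b c h))"
    unfolding Hh set_lebesgue_integral_def scaleR_sum_right
    using w by (simp add: set_integrable_def mult.left_commute[of "indicator _ _"])
  also have "\<dots> = (\<Sum>b\<in>Basis. \<Sum>c\<in>Basis. if b = c then (H b \<bullet> b) * (?V * (r\<^sup>2 / (DIM('a) + 2))) else 0)"
    by (intro sum.cong refl) (simp add: ball_integral_coordinate_products[OF r])
  also have "\<dots> = ?V * (r\<^sup>2 / (DIM('a) + 2)) * (\<Sum>b\<in>Basis. H b \<bullet> b)"
    by (simp add: sum_distrib_left sum_divide_distrib mult_ac)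
  finally have IH: "(LINT h:?B|lborel. H h \<bullet> h) = \<dots>" .
  have "(LINT h:?B|lborel. h \<bullet> b) = 0" if "b \<in> Basis" for b
    using that by (intro ball_integral_odd[of b]) (auto simp: inner_diff_left)
  moreover define gb where "gb b = g \<bullet> b" for b
  have gh: "g \<bullet> h = (\<Sum>b\<in>Basis. gb b * (h \<bullet> b))" for h
    unfolding gb_def by (rule euclidean_inner)
  have "set_integrable lborel ?B (\<lambda>h. h \<bullet> b)" for b
    by (intro int continuous_intros)
  then have "(LINT h:?B|lborel. g \<bullet> h) = (\<Sum>b\<in>Basis. gb b * (LINT h:?B|lborel. h \<bullet> b))"
    unfolding set_lebesgue_integral_def gh scaleR_sum_right
    by (simp add: set_integrable_def mult.left_commute[of "indicator _ _"])
  ultimately have Ig: "(LINT h:?B|lborel. g \<bullet> h) = 0" by simp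
  have I: "set_integrable lborel ?B (\<lambda>h. k)" "set_integrable lborel ?B (\<lambda>h. g \<bullet> h)"
    "set_integrable lborel ?B (\<lambda>h. H h \<bullet> h)"
    by (rule int; intro continuous_on_inner continuous_on_const continuous_on_id linear_continuous_on[OF H])+
  have "(LINT h:?B|lborel. q h) = (LINT h:?B|lborel. k) + (LINT h:?B|lborel. g \<bullet> h)
      + (LINT h:?B|lborel. H h \<bullet> h) / 2"
    unfolding q_def using I by (simp add: set_integral_add)
  also have "(LINT h:?B|lborel. k) = k * ?V"
    using emeasure_lborel_ball_finite[of "0::'a" r] by (simp add: set_lebesgue_integral_def)
  finally show ?thesis unfolding Ig IH by (simp add: algebra_simps)
qed

text \<open>On a small ball \<open>f\<close> differs from its quadratic Taylor polynomial by at most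
  \<open>\<eta> * r\<^sup>2\<close>, hence so do the averages. Continuity near \<open>x\<close>
  supplies the integrability of \<open>f\<close>.\<close>

lemma ball_average_second_order:
  fixes f :: "'a::euclidean_space \<Rightarrow> real"
  assumes exp: "second_order_expansion f x g H" and R: "R > 0" and cont: "continuous_on (ball x R) f"
    and \<eta>: "\<eta> > 0"
  shows "\<exists>\<delta>>0. \<forall>r. 0 < r \<and> r < \<delta> \<longrightarrow>
    \<bar>1 / measure lborel (ball x r) * (LINT y:ball x r|lborel. f y) - f x
      - r\<^sup>2 / (2 * (DIM('a) + 2)) * (\<Sum>b\<in>Basis. H b \<bullet> b)\<bar> \<le> \<eta> * r\<^sup>2"
proof -
  from exp have H: "bounded_linear H" unfolding second_order_expansion_def by simp
  from exp \<eta> obtain \<delta> where \<delta>: "\<delta> > 0" and T: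
    "\<And>h. norm h < \<delta> \<Longrightarrow> \<bar>f (x + h) - f x - g \<bullet> h - (H h \<bullet> h) / 2\<bar> \<le> \<eta> * (norm h)\<^sup>2"
    unfolding second_order_expansion_def by blast
  have "\<bar>1 / measure lborel (ball x r) * (LINT y:ball x r|lborel. f y) - f x
      - r\<^sup>2 / (2 * (DIM('a) + 2)) * (\<Sum>b\<in>Basis. H b \<bullet> b)\<bar> \<le> \<eta> * r\<^sup>2"
    if r: "0 < r" "r < min \<delta> R" for r
  proof -
    let ?B = "ball (0::'a) r" and ?V = "measure lborel (ball (0::'a) r)"
    define q where "q h = f x + g \<bullet> h + (H h \<bullet> h) / 2" for h
    have V: "?V > 0" using r by (intro content_ball_pos)
    have Vx: "measure lborel (ball x r) = ?V"
      using content_ball_conv_unit_ball[of r x] content_ball_conv_unit_ball[of r "0::'a"] r by simp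
    have fi: "set_integrable lborel (ball x r) f"
      using r by (intro set_integrable_ball_continuous continuous_on_subset[OF cont]) auto
    have qi: "set_integrable lborel ?B q"
      unfolding q_def
      by (intro set_integrable_ball_continuous continuous_intros linear_continuous_on H) simp
    have ci: "set_integrable lborel ?B (\<lambda>h. c)" for c :: real
      by (intro set_integrable_ball_continuous continuous_intros)
    have cI: "(LINT h:?B|lborel. c) = c * ?V" for c
      using emeasure_lborel_ball_finite[of "0::'a" r] by (simp add: set_lebesgue_integral_def)
    have di: "set_integrable lborel ?B (\<lambda>h. f (x + h) - q h)"
      using ball_integral_shift(1)[OF fi] qi by (rule set_integral_diff)
    have bnd: "\<bar>f (x + h) - q h\<bar> \<le> \<eta> * r\<^sup>2" if "h \<in> ?B" for h
    proof -
      have "\<eta> * (norm h)\<^sup>2 \<le> \<eta> * r\<^sup>2" using that \<eta> by (intro mult_left_mono power_mono) auto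
      moreover have "\<bar>f (x + h) - q h\<bar> \<le> \<eta> * (norm h)\<^sup>2"
        using T[of h] that r by (simp add: q_def algebra_simps)
      ultimately show ?thesis by linarith
    qed
    have "(LINT h:?B|lborel. f (x + h) - q h) \<le> (LINT h:?B|lborel. \<eta> * r\<^sup>2)"
      "(LINT h:?B|lborel. - (\<eta> * r\<^sup>2)) \<le> (LINT h:?B|lborel. f (x + h) - q h)"
      using bnd by (intro set_integral_mono di ci; fastforce simp: abs_le_iff)+
    moreover have "(LINT h:?B|lborel. f (x + h) - q h)
        = (LINT y:ball x r|lborel. f y) - ?V * (f x + r\<^sup>2 / (2 * (DIM('a) + 2)) * (\<Sum>b\<in>Basis. H b \<bullet> b))"
      using set_integral_diff(2)[OF ball_integral_shift(1)[OF fi] qi]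
        ball_integral_shift(2)[OF fi] ball_average_quadratic[OF r(1) H, of "f x" g]
      by (simp add: q_def)
    ultimately have "\<bar>(LINT y:ball x r|lborel. f y) - ?V * (f x + r\<^sup>2 / (2 * (DIM('a) + 2)) * (\<Sum>b\<in>Basis. H b \<bullet> b))\<bar>
        \<le> ?V * (\<eta> * r\<^sup>2)"
      unfolding cI by (simp add: abs_le_iff mult.commute)
    then have "\<bar>(LINT y:ball x r|lborel. f y) / ?V - (f x + r\<^sup>2 / (2 * (DIM('a) + 2)) * (\<Sum>b\<in>Basis. H b \<bullet> b))\<bar>
        \<le> \<eta> * r\<^sup>2"
    proof -
      assume A: "\<bar>(LINT y:ball x r|lborel. f y) - ?V * (f x + r\<^sup>2 / (2 * (DIM('a) + 2)) * (\<Sum>b\<in>Basis. H b \<bullet> b))\<bar>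
        \<le> ?V * (\<eta> * r\<^sup>2)"
      have "(X / ?V - Y) = (X - ?V * Y) / ?V" for X Y using V by (simp add: field_simps)
      then show ?thesis using A V by (simp only: abs_divide) (simp add: pos_divide_le_eq mult_ac)
    qed
    then show ?thesis unfolding Vx by (simp add: algebra_simps)
  qed
  with \<delta> R show ?thesis by (intro exI[of _ "min \<delta> R"]) auto
qed

section \<open>Expansion of the mean operator\<close>

lemma INF_eq_uminus_SUP: "(INF y\<in>A. f y) = - (SUP y\<in>A. - f y :: real)"
  by (simp add: Inf_real_def image_image)

lemma mean_op_uminus: "mean_op p \<rho> (\<lambda>y. - \<phi> y) x = - mean_op p \<rho> \<phi> x"
  unfolding mean_op_def Let_def INF_eq_uminus_SUP
  by (simp add: set_lebesgue_integral_def algebra_simps)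

text \<open>Here \<open>s\<close> and \<open>i\<close> stand for the suprema of \<open>f\<close> and
  \<open>-f\<close>. Both contain the first-order term \<open>a\<close>, which cancels in
  \<open>(s - i) / 2\<close>, so that the second-order term \<open>b\<close> becomes
  visible.\<close>

lemma abs_half_diff_le:
  fixes a b e :: real
  assumes "\<bar>s - c - a - b\<bar> \<le> e" "\<bar>i + c - a + b\<bar> \<le> e"
  shows "\<bar>(s - i) / 2 - c - b\<bar> \<le> e"
  using assms unfolding abs_le_iff by (simp add: field_simps)

text \<open>The half-sum of supremum and infimum sees the second derivative in the direction of the
  gradient, the average sees the trace. The weights combine them into the normalized
  \<open>p\<close>-Laplacian.\<close>

lemma mean_op_second_order:
  fixes f :: "'a::euclidean_space \<Rightarrow> real"
  assumes p: "p > 2" and exp: "second_order_expansion f x g H" and R: "R > 0"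
    and cont: "continuous_on (ball x R) f" and g: "g \<noteq> 0" and \<eta>: "\<eta> > 0"
  shows "\<exists>\<delta>>0. \<forall>\<rho>. 0 < \<rho> \<and> \<rho> < \<delta> \<longrightarrow>
    \<bar>mean_op p \<rho> f x - f x
      - \<rho>\<^sup>2 * ((\<Sum>b\<in>Basis. H b \<bullet> b) + (p - 2) * (H (sgn g) \<bullet> sgn g))\<bar> \<le> \<eta> * \<rho>\<^sup>2"
proof -
  define d where "d = real DIM('a)"
  define \<beta> where "\<beta> = coef_beta p DIM('a)"
  define \<gamma> where "\<gamma> = coef_gamma p DIM('a)"
  define tr where "tr = (\<Sum>b\<in>Basis. H b \<bullet> b)"
  define Q where "Q = H (sgn g) \<bullet> sgn g"
  have d: "d > 0" by (simp add: d_def)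
  have \<beta>: "\<beta> = (p - 2) / (p + d)" "0 < \<beta>" "\<beta> < 1" using p d by (auto simp: \<beta>_def coef_beta_def d_def)
  have \<gamma>: "\<gamma>\<^sup>2 = 2 * (p + d)" "\<gamma> > 0" using p d by (auto simp: \<gamma>_def coef_gamma_def d_def)
  \<comment> \<open>These two identities are what \<open>coef_beta\<close> and
    \<open>coef_gamma\<close> are tuned for: coefficient \<open>p - 2\<close> for the directional
    term and 1 for the trace.\<close>
  have coef: "\<beta> / 2 * \<gamma>\<^sup>2 = p - 2" "(1 - \<beta>) * (\<gamma>\<^sup>2 / (2 * (d + 2))) = 1"
  proof -
    define e w where "e = p + d" and "w = d + 2"
    have ew: "e \<noteq> 0" "w \<noteq> 0" "\<gamma>\<^sup>2 = 2 * e" "\<beta> = (p - 2) / e" using p d by (auto simp: e_def w_def \<beta>(1) \<gamma>(1))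
    have "1 - \<beta> = w / e" using p d by (simp add: e_def w_def \<beta>(1) field_simps)
    then show "\<beta> / 2 * \<gamma>\<^sup>2 = p - 2" "(1 - \<beta>) * (\<gamma>\<^sup>2 / (2 * (d + 2))) = 1"
      unfolding w_def[symmetric] ew(3) using ew(1,2) by (simp_all add: ew(4))
  qed
  \<comment> \<open>The balls have radius \<open>\<gamma> * \<rho>\<close>, so an error
    \<open>\<eta>' * r\<^sup>2\<close> is exactly \<open>\<eta> * \<rho>\<^sup>2\<close>.\<close>
  define \<eta>' where "\<eta>' = \<eta> / \<gamma>\<^sup>2"
  have \<eta>': "\<eta>' > 0" using \<eta> \<gamma>(2) by (simp add: \<eta>'_def)
  from SUP_ball_second_order[OF exp g \<eta>'] obtain \<delta>1 where \<delta>1: "\<delta>1 > 0"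
    and S: "\<And>r. 0 < r \<Longrightarrow> r < \<delta>1 \<Longrightarrow> \<bar>(SUP y\<in>ball x r. f y) - f x - r * norm g - r\<^sup>2 * Q / 2\<bar> \<le> \<eta>' * r\<^sup>2"
    unfolding Q_def by blast
  from SUP_ball_second_order[OF second_order_expansion_uminus[OF exp] _ \<eta>'] g obtain \<delta>2 where \<delta>2: "\<delta>2 > 0"
    and I: "\<And>r. 0 < r \<Longrightarrow> r < \<delta>2 \<Longrightarrow>
      \<bar>(SUP y\<in>ball x r. - f y) - - f x - r * norm (- g) - r\<^sup>2 * (- H (sgn (- g)) \<bullet> sgn (- g)) / 2\<bar> \<le> \<eta>' * r\<^sup>2"
    by (auto simp del: norm_minus_cancel)
  have lin: "linear H" using exp unfolding second_order_expansion_def by (auto intro: bounded_linear.linear)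
  have Qm: "- H (sgn (- g)) \<bullet> sgn (- g) = - Q"
    by (simp add: Q_def sgn_minus linear_neg[OF lin])
  from ball_average_second_order[OF exp R cont \<eta>'] obtain \<delta>3 where \<delta>3: "\<delta>3 > 0"
    and A: "\<And>r. 0 < r \<Longrightarrow> r < \<delta>3 \<Longrightarrow> \<bar>1 / measure lborel (ball x r) * (LINT y:ball x r|lborel. f y) - f x
      - r\<^sup>2 / (2 * (d + 2)) * tr\<bar> \<le> \<eta>' * r\<^sup>2"
    unfolding d_def tr_def by (auto simp: add.commute)
  define \<delta> where "\<delta> = min \<delta>1 (min \<delta>2 \<delta>3) / \<gamma>"
  have "\<bar>mean_op p \<rho> f x - f x - \<rho>\<^sup>2 * (tr + (p - 2) * Q)\<bar> \<le> \<eta> * \<rho>\<^sup>2"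
    if \<rho>: "0 < \<rho>" "\<rho> < \<delta>" for \<rho>
  proof -
    define r where "r = \<gamma> * \<rho>"
    have r: "0 < r" "r < \<delta>1" "r < \<delta>2" "r < \<delta>3"
      using \<rho> \<gamma> by (auto simp: r_def \<delta>_def field_simps)
    define s i m where "s = (SUP y\<in>ball x r. f y)" and "i = (SUP y\<in>ball x r. - f y)"
      and "m = 1 / measure lborel (ball x r) * (LINT y:ball x r|lborel. f y)"
    have "\<bar>s - f x - r * norm g - r\<^sup>2 * Q / 2\<bar> \<le> \<eta>' * r\<^sup>2"
      using S[OF r(1,2)] by (simp add: s_def)
    moreover have "\<bar>i + f x - r * norm g + r\<^sup>2 * Q / 2\<bar> \<le> \<eta>' * r\<^sup>2"
      using I[OF r(1,3)] unfolding Qm by (simp add: i_def)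
    ultimately have "\<bar>(s - i) / 2 - f x - r\<^sup>2 * Q / 2\<bar> \<le> \<eta>' * r\<^sup>2"
      by (rule abs_half_diff_le)
    then have 1: "\<bar>\<beta> * ((s - i) / 2 - f x - r\<^sup>2 * Q / 2)\<bar> \<le> \<beta> * (\<eta>' * r\<^sup>2)"
      unfolding abs_mult using \<beta>(2) by (intro mult_mono) auto
    have "\<bar>m - f x - r\<^sup>2 / (2 * (d + 2)) * tr\<bar> \<le> \<eta>' * r\<^sup>2"
      using A[OF r(1,4)] by (simp add: m_def)
    then have 2: "\<bar>(1 - \<beta>) * (m - f x - r\<^sup>2 / (2 * (d + 2)) * tr)\<bar> \<le> (1 - \<beta>) * (\<eta>' * r\<^sup>2)"
      unfolding abs_mult using \<beta>(3) by (intro mult_mono) auto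
    have "mean_op p \<rho> f x = \<beta> / 2 * (s - i) + (1 - \<beta>) * m"
      unfolding mean_op_def Let_def INF_eq_uminus_SUP by (simp add: s_def i_def m_def r_def \<beta>_def \<gamma>_def)
    moreover have "\<rho>\<^sup>2 * (tr + (p - 2) * Q) = \<beta> / 2 * r\<^sup>2 * Q + (1 - \<beta>) * (r\<^sup>2 / (2 * (d + 2))) * tr"
    proof -
      have eqs: "\<beta> / 2 * r\<^sup>2 = \<rho>\<^sup>2 * (\<beta> / 2 * \<gamma>\<^sup>2)" "(1 - \<beta>) * (r\<^sup>2 / (2 * (d + 2))) = \<rho>\<^sup>2 * ((1 - \<beta>) * (\<gamma>\<^sup>2 / (2 * (d + 2))))"
        by (simp_all add: r_def power_mult_distrib)
      show ?thesis unfolding eqs coef by (simp add: algebra_simps)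
    qed
    ultimately have "mean_op p \<rho> f x - f x - \<rho>\<^sup>2 * (tr + (p - 2) * Q)
        = \<beta> * ((s - i) / 2 - f x - r\<^sup>2 * Q / 2) + (1 - \<beta>) * (m - f x - r\<^sup>2 / (2 * (d + 2)) * tr)"
      by (simp add: algebra_simps)
    also have "\<bar>\<dots>\<bar> \<le> \<beta> * (\<eta>' * r\<^sup>2) + (1 - \<beta>) * (\<eta>' * r\<^sup>2)"
      using 1 2 by (rule order_trans[OF abs_triangle_ineq add_mono])
    also have "\<dots> = \<eta>' * r\<^sup>2" by (simp only: distrib_right[symmetric]) simp
    also have "\<dots> = \<eta> * \<rho>\<^sup>2"
      using \<gamma>(2) by (simp add: \<eta>'_def r_def power_mult_distrib)
    finally show ?thesis .
  qed
  moreover have "\<delta> > 0" using \<delta>1 \<delta>2 \<delta>3 \<gamma> by (simp add: \<delta>_def)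
  ultimately show ?thesis
    unfolding tr_def[symmetric] Q_def[symmetric] by (intro exI[of _ \<delta>]) auto
qed

text \<open>The first-order terms of supremum and infimum cancel at critical points too, and the
  rest is of second order. There the quotient by \<open>\<rho>\<^sup>2\<close> need not converge to
  the expression in \<open>mean_op_second_order\<close>, but it stays bounded.\<close>

lemma mean_op_first_order:
  fixes f :: "'a::euclidean_space \<Rightarrow> real"
  assumes p: "p > 2" and exp: "second_order_expansion f x g H" and R: "R > 0"
    and cont: "continuous_on (ball x R) f"
  shows "\<exists>K>0. \<exists>\<delta>>0. \<forall>\<rho>. 0 < \<rho> \<and> \<rho> < \<delta> \<longrightarrow> \<bar>mean_op p \<rho> f x - f x\<bar> \<le> K * \<rho>\<^sup>2"
proof -
  define \<beta> where "\<beta> = coef_beta p DIM('a)"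
  define \<gamma> where "\<gamma> = coef_gamma p DIM('a)"
  have \<beta>: "0 < \<beta>" "\<beta> < 1" using p by (auto simp: \<beta>_def coef_beta_def)
  have \<gamma>: "\<gamma> > 0" using p by (auto simp: \<gamma>_def coef_gamma_def)
  from second_order_expansion_first_order[OF exp] obtain K1 \<delta>1 where K1: "K1 > 0" "\<delta>1 > 0"
    and T: "\<And>h. norm h < \<delta>1 \<Longrightarrow> \<bar>f (x + h) - f x - g \<bullet> h\<bar> \<le> K1 * (norm h)\<^sup>2"
    by blast
  have T': "\<bar>- f (x + h) - - f x - (- g) \<bullet> h\<bar> \<le> K1 * (norm h)\<^sup>2" if "norm h < \<delta>1" for h
    using T[OF that] by (simp add: abs_if split: if_splits)
  define tr where "tr = (\<Sum>b\<in>Basis. H b \<bullet> b)"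
  define c where "c = 2 * (real DIM('a) + 2)"
  have c: "c \<ge> 1" by (simp add: c_def)
  from ball_average_second_order[OF exp R cont zero_less_one] obtain \<delta>2 where \<delta>2: "\<delta>2 > 0"
    and A: "\<And>r. 0 < r \<Longrightarrow> r < \<delta>2 \<Longrightarrow> \<bar>1 / measure lborel (ball x r) * (LINT y:ball x r|lborel. f y) - f x
      - r\<^sup>2 / c * tr\<bar> \<le> 1 * r\<^sup>2"
    unfolding tr_def c_def by (auto simp: add.commute)
  define \<delta> where "\<delta> = min \<delta>1 \<delta>2 / \<gamma>"
  have "\<bar>mean_op p \<rho> f x - f x\<bar> \<le> (K1 + (1 + \<bar>tr\<bar>)) * \<gamma>\<^sup>2 * \<rho>\<^sup>2" if \<rho>: "0 < \<rho>" "\<rho> < \<delta>" for \<rho>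
  proof -
    define r where "r = \<gamma> * \<rho>"
    have r: "0 < r" "r < \<delta>1" "r < \<delta>2"
      using \<rho> \<gamma> by (auto simp: r_def \<delta>_def field_simps)
    define s i m where "s = (SUP y\<in>ball x r. f y)" and "i = (SUP y\<in>ball x r. - f y)"
      and "m = 1 / measure lborel (ball x r) * (LINT y:ball x r|lborel. f y)"
    have "\<bar>s - f x - r * norm g\<bar> \<le> K1 * r\<^sup>2"
      unfolding s_def by (rule SUP_ball_first_order(1)[of r \<delta>1]) (use r K1 T in auto)
    moreover have "\<bar>i - - f x - r * norm (- g)\<bar> \<le> K1 * r\<^sup>2"
      unfolding i_def by (rule SUP_ball_first_order(1)[of r \<delta>1]) (use r K1 T' in auto)
    ultimately have "\<bar>(s - i) / 2 - f x\<bar> \<le> K1 * r\<^sup>2"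
      using abs_half_diff_le[of s "f x" "r * norm g" 0 "K1 * r\<^sup>2" i] by simp
    then have 1: "\<bar>\<beta> * ((s - i) / 2 - f x)\<bar> \<le> 1 * (K1 * r\<^sup>2)"
      unfolding abs_mult using \<beta> by (intro mult_mono) auto
    have "r\<^sup>2 * \<bar>tr\<bar> / c \<le> r\<^sup>2 * \<bar>tr\<bar> / 1" using c by (intro divide_left_mono) auto
    then have "\<bar>r\<^sup>2 / c * tr\<bar> \<le> r\<^sup>2 * \<bar>tr\<bar>" using c by (simp add: abs_mult)
    moreover have "\<bar>m - f x - r\<^sup>2 / c * tr\<bar> \<le> r\<^sup>2"
      using A[OF r(1,3)] by (simp add: m_def)
    ultimately have "\<bar>m - f x\<bar> \<le> r\<^sup>2 + r\<^sup>2 * \<bar>tr\<bar>" by linarith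
    then have "\<bar>m - f x\<bar> \<le> (1 + \<bar>tr\<bar>) * r\<^sup>2" by (simp add: algebra_simps)
    then have 2: "\<bar>(1 - \<beta>) * (m - f x)\<bar> \<le> 1 * ((1 + \<bar>tr\<bar>) * r\<^sup>2)"
      unfolding abs_mult using \<beta> by (intro mult_mono) auto
    have "mean_op p \<rho> f x = \<beta> / 2 * (s - i) + (1 - \<beta>) * m"
      unfolding mean_op_def Let_def INF_eq_uminus_SUP by (simp add: s_def i_def m_def r_def \<beta>_def \<gamma>_def)
    then have "mean_op p \<rho> f x - f x = \<beta> * ((s - i) / 2 - f x) + (1 - \<beta>) * (m - f x)"
      by (simp add: algebra_simps)
    also have "\<bar>\<dots>\<bar> \<le> 1 * (K1 * r\<^sup>2) + 1 * ((1 + \<bar>tr\<bar>) * r\<^sup>2)"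
      using 1 2 by (rule order_trans[OF abs_triangle_ineq add_mono])
    finally show ?thesis by (simp add: r_def power_mult_distrib algebra_simps)
  qed
  moreover have "\<delta> > 0" using K1 \<delta>2 \<gamma> by (simp add: \<delta>_def)
  moreover have "(K1 + (1 + \<bar>tr\<bar>)) * \<gamma>\<^sup>2 > 0" using K1 \<gamma> by (simp add: add_pos_nonneg)
  ultimately show ?thesis by blast
qed

section \<open>The infimum over the parameter\<close>

text \<open>
  One half of the nonlinear average, with \<open>S r\<close> and \<open>N \<rho>\<close> in the roles of the increments
  \<open>sup\<^sub>B \<phi> - \<phi>\<close> and \<open>M\<^sub>\<rho>[\<phi>] - \<phi>\<close> at the base point.  Minimizing
  \<open>a c\<^sup>1\<^sup>-\<^sup>a g + (1 - a) c\<^sup>-\<^sup>a L\<close> over \<open>c > 0\<close> gives \<open>g\<^sup>a L\<^sup>1\<^sup>-\<^sup>a\<close>, attained at \<open>c = L / g\<close>.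
\<close>

lemma INF_family_limit:
  fixes S N m M :: "real \<Rightarrow> real" and a g L K r0 :: real
  assumes a: "0 < a" "a < 1" and g: "g \<ge> 0" and K: "K > 0" and r0: "r0 > 0"
    and S: "\<And>r. 0 < r \<Longrightarrow> r < r0 \<Longrightarrow> \<bar>S r - r * g\<bar> \<le> K * r\<^sup>2"
    and N: "\<And>\<rho>. 0 < \<rho> \<Longrightarrow> \<rho> < r0 \<Longrightarrow> \<bar>N \<rho>\<bar> \<le> K * \<rho>\<^sup>2"
    and NL: "g > 0 \<Longrightarrow> ((\<lambda>\<rho>. N \<rho> / \<rho>\<^sup>2) \<longlongrightarrow> L) (at_right 0)"
    and m0: "\<And>\<epsilon>. \<epsilon> > 0 \<Longrightarrow> m \<epsilon> > 0"
    and m: "(m \<longlongrightarrow> 0) (at_right 0)" and M: "filterlim M at_top (at_right 0)"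
    and small_S: "((\<lambda>\<epsilon>. \<epsilon> * M \<epsilon> powr (1 - a)) \<longlongrightarrow> 0) (at_right 0)"
    and small_N: "((\<lambda>\<epsilon>. \<epsilon> * m \<epsilon> powr (- a / 2)) \<longlongrightarrow> 0) (at_right 0)"
  shows "((\<lambda>\<epsilon>. max (INF c\<in>{m \<epsilon>..M \<epsilon>}. a * S (\<epsilon>\<^sup>2 * c powr (1 - a))
      + (1 - a) * N (\<epsilon> * c powr (- a / 2))) 0 / \<epsilon>\<^sup>2)
    \<longlongrightarrow> max L 0 powr (1 - a) * g powr a) (at_right 0)" (is ?limit)
    and "\<forall>\<^sub>F \<epsilon> in at_right 0. bdd_below ((\<lambda>c. a * S (\<epsilon>\<^sup>2 * c powr (1 - a))
      + (1 - a) * N (\<epsilon> * c powr (- a / 2))) ` {m \<epsilon>..M \<epsilon>})" (is ?bdd)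
proof -
  define \<tau> where "\<tau> \<epsilon> c = a * S (\<epsilon>\<^sup>2 * c powr (1 - a)) + (1 - a) * N (\<epsilon> * c powr (- a / 2))" for \<epsilon> c
  define X where "X \<epsilon> = max (INF c\<in>{m \<epsilon>..M \<epsilon>}. \<tau> \<epsilon> c) 0 / \<epsilon>\<^sup>2" for \<epsilon>
  define l where "l = max L 0 powr (1 - a) * g powr a"
  have l0: "l \<ge> 0" by (simp add: l_def)
  have pos: "\<forall>\<^sub>F \<epsilon> in at_right 0. 0 < \<epsilon> \<and> \<epsilon> < (1::real)"
    by (rule eventually_at_rightI[of 0 1]) auto
  \<comment> \<open>The radius for \<open>S\<close> is largest at \<open>c = M \<epsilon>\<close>
    and the one for \<open>N\<close> at \<open>c = m \<epsilon>\<close>. Smallness at the two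
    endpoints is thus smallness uniform in \<open>c\<close>.\<close>
  have radS: "\<epsilon>\<^sup>2 * c powr (1 - a) \<le> \<epsilon> * (\<epsilon> * M \<epsilon> powr (1 - a))" "0 < \<epsilon>\<^sup>2 * c powr (1 - a)"
    and radN: "\<epsilon> * c powr (- a / 2) \<le> \<epsilon> * m \<epsilon> powr (- a / 2)" "0 < \<epsilon> * c powr (- a / 2)"
    if "0 < \<epsilon>" "c \<in> {m \<epsilon>..M \<epsilon>}" for \<epsilon> c
  proof -
    from that m0[of \<epsilon>] have c: "c > 0" "m \<epsilon> \<le> c" "c \<le> M \<epsilon>" "m \<epsilon> > 0" by auto
    have "c powr (1 - a) \<le> M \<epsilon> powr (1 - a)" using c a by (intro powr_mono2) auto
    then show "\<epsilon>\<^sup>2 * c powr (1 - a) \<le> \<epsilon> * (\<epsilon> * M \<epsilon> powr (1 - a))"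
      using that by (simp add: power2_eq_square)
    have "c powr (- a / 2) \<le> m \<epsilon> powr (- a / 2)" using c a by (intro powr_mono2') auto
    then show "\<epsilon> * c powr (- a / 2) \<le> \<epsilon> * m \<epsilon> powr (- a / 2)"
      using that by simp
    show "0 < \<epsilon>\<^sup>2 * c powr (1 - a)" "0 < \<epsilon> * c powr (- a / 2)" using that c by auto
  qed
  have evS: "\<forall>\<^sub>F \<epsilon> in at_right 0. \<epsilon> * M \<epsilon> powr (1 - a) < \<delta>" if "\<delta> > 0" for \<delta>
    using order_tendstoD(2)[OF small_S that] .
  have evN: "\<forall>\<^sub>F \<epsilon> in at_right 0. \<epsilon> * m \<epsilon> powr (- a / 2) < \<delta>" if "\<delta> > 0" for \<delta>
    using order_tendstoD(2)[OF small_N that] .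
  have mM: "\<forall>\<^sub>F \<epsilon> in at_right 0. c \<in> {m \<epsilon>..M \<epsilon>}" if "c > 0" for c
    using order_tendstoD(2)[OF m that] M[unfolded filterlim_at_top, rule_format, of c]
    by eventually_elim auto
  \<comment> \<open>A crude lower bound is enough here; it makes the infimum over \<open>c\<close> a
    true lower bound rather than an unspecified real.\<close>
  have bdd: "\<forall>\<^sub>F \<epsilon> in at_right 0. bdd_below (\<tau> \<epsilon> ` {m \<epsilon>..M \<epsilon>})"
    using pos evS[OF r0] evN[OF r0]
  proof eventually_elim
    case (elim \<epsilon>)
    show ?case
    proof (rule bdd_belowI2)
      fix c assume c: "c \<in> {m \<epsilon>..M \<epsilon>}"
      let ?r = "\<epsilon>\<^sup>2 * c powr (1 - a)" and ?\<rho> = "\<epsilon> * c powr (- a / 2)"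
      have \<epsilon>: "0 < \<epsilon>" "\<epsilon> < 1" using elim by auto
      have "\<epsilon> * (\<epsilon> * M \<epsilon> powr (1 - a)) \<le> \<epsilon> * M \<epsilon> powr (1 - a)"
        using \<epsilon> by (intro mult_left_le_one_le) auto
      then have r: "0 < ?r" "?r < r0" and \<rho>: "0 < ?\<rho>" "?\<rho> < r0"
        using radS[OF \<epsilon>(1) c] radN[OF \<epsilon>(1) c] elim by linarith+
      have "K * ?r\<^sup>2 \<le> K * r0\<^sup>2" "K * ?\<rho>\<^sup>2 \<le> K * r0\<^sup>2"
        using r \<rho> K by (auto intro!: mult_left_mono power_mono)
      moreover have "0 \<le> ?r * g" using r g by simp
      ultimately have "S ?r \<ge> - (K * r0\<^sup>2)" "N ?\<rho> \<ge> - (K * r0\<^sup>2)"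
        using S[OF r] N[OF \<rho>] by linarith+
      then have "a * (- (K * r0\<^sup>2)) + (1 - a) * (- (K * r0\<^sup>2)) \<le> \<tau> \<epsilon> c"
        unfolding \<tau>_def using a by (intro add_mono mult_left_mono) auto
      then show "- (K * r0\<^sup>2) \<le> \<tau> \<epsilon> c" by (simp add: algebra_simps)
    qed
  qed
  \<comment> \<open>Any fixed \<open>c\<close> eventually belongs to the interval and competes in
    the infimum, so upper bounds only require limits at fixed \<open>c\<close>.\<close>
  have upper: "\<forall>\<^sub>F \<epsilon> in at_right 0. X \<epsilon> < l + \<eta>"
    if c: "c > 0" and \<eta>: "\<eta> > 0" and T: "\<forall>\<^sub>F \<epsilon> in at_right 0. \<tau> \<epsilon> c / \<epsilon>\<^sup>2 < l + \<eta>" for c \<eta>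
    using T mM[OF c] bdd pos
  proof eventually_elim
    case (elim \<epsilon>)
    then have "(INF c\<in>{m \<epsilon>..M \<epsilon>}. \<tau> \<epsilon> c) \<le> \<tau> \<epsilon> c" by (intro cINF_lower) auto
    then have "(INF c\<in>{m \<epsilon>..M \<epsilon>}. \<tau> \<epsilon> c) / \<epsilon>\<^sup>2 < l + \<eta>"
      using elim by (meson divide_right_mono le_less_trans zero_le_power2)
    then show ?case using l0 \<eta> by (auto simp: X_def max_def)
  qed
  have rad_fixed: "((\<lambda>\<epsilon>. \<epsilon>\<^sup>2 * c powr (1 - a)) \<longlongrightarrow> 0) (at_right 0)"
    "((\<lambda>\<epsilon>. \<epsilon> * c powr (- a / 2)) \<longlongrightarrow> 0) (at_right 0)" for c
    by (auto intro!: tendsto_eq_intros)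
  have rho2: "(\<epsilon> * c powr (- a / 2))\<^sup>2 = \<epsilon>\<^sup>2 * c powr (- a)" if "c > 0" for \<epsilon> c
    using that by (simp add: power_mult_distrib powr_power)
  have limS: "((\<lambda>\<epsilon>. S (\<epsilon>\<^sup>2 * c powr (1 - a)) / \<epsilon>\<^sup>2) \<longlongrightarrow> c powr (1 - a) * g) (at_right 0)"
    if c: "c > 0" for c
  proof -
    have "\<forall>\<^sub>F \<epsilon> in at_right 0.
        norm (S (\<epsilon>\<^sup>2 * c powr (1 - a)) / \<epsilon>\<^sup>2 - c powr (1 - a) * g) \<le> K * \<epsilon>\<^sup>2 * (c powr (1 - a))\<^sup>2"
      using order_tendstoD(2)[OF rad_fixed(1)[of c] r0] pos
    proof eventually_elim
      case (elim \<epsilon>)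
      then have \<epsilon>: "\<epsilon> > 0" by simp
      have "\<bar>S (\<epsilon>\<^sup>2 * c powr (1 - a)) - \<epsilon>\<^sup>2 * c powr (1 - a) * g\<bar> / \<epsilon>\<^sup>2 \<le> K * (\<epsilon>\<^sup>2 * c powr (1 - a))\<^sup>2 / \<epsilon>\<^sup>2"
        using S[of "\<epsilon>\<^sup>2 * c powr (1 - a)"] elim c by (intro divide_right_mono) auto
      also have "\<bar>S (\<epsilon>\<^sup>2 * c powr (1 - a)) - \<epsilon>\<^sup>2 * c powr (1 - a) * g\<bar> / \<epsilon>\<^sup>2
          = \<bar>(S (\<epsilon>\<^sup>2 * c powr (1 - a)) - \<epsilon>\<^sup>2 * c powr (1 - a) * g) / \<epsilon>\<^sup>2\<bar>"
        by (simp add: abs_divide)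
      also have "(S (\<epsilon>\<^sup>2 * c powr (1 - a)) - \<epsilon>\<^sup>2 * c powr (1 - a) * g) / \<epsilon>\<^sup>2
          = S (\<epsilon>\<^sup>2 * c powr (1 - a)) / \<epsilon>\<^sup>2 - c powr (1 - a) * g"
        using \<epsilon> by (simp add: diff_divide_distrib)
      finally show ?case using \<epsilon> by (simp add: power_mult_distrib power2_eq_square mult_ac)
    qed
    moreover have "((\<lambda>\<epsilon>. K * \<epsilon>\<^sup>2 * (c powr (1 - a))\<^sup>2) \<longlongrightarrow> 0) (at_right 0)"
      by (auto intro!: tendsto_eq_intros)
    ultimately have "((\<lambda>\<epsilon>. S (\<epsilon>\<^sup>2 * c powr (1 - a)) / \<epsilon>\<^sup>2 - c powr (1 - a) * g) \<longlongrightarrow> 0) (at_right 0)"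
      by (rule Lim_null_comparison)
    then show ?thesis by (simp add: LIM_zero_iff)
  qed
  have limT: "((\<lambda>\<epsilon>. \<tau> \<epsilon> c / \<epsilon>\<^sup>2) \<longlongrightarrow> a * (c powr (1 - a) * g) + (1 - a) * (L * c powr (- a))) (at_right 0)"
    if c: "c > 0" and g: "g > 0" for c
  proof -
    have "filterlim (\<lambda>\<epsilon>. \<epsilon> * c powr (- a / 2)) (at_right 0) (at_right 0)"
      using c rad_fixed(2)[of c] pos unfolding filterlim_at
      by (auto elim: eventually_mono)
    from filterlim_compose[OF NL[OF g] this]
    have "((\<lambda>\<epsilon>. N (\<epsilon> * c powr (- a / 2)) / (\<epsilon> * c powr (- a / 2))\<^sup>2 * c powr (- a)) \<longlongrightarrow> L * c powr (- a)) (at_right 0)"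
      by (rule tendsto_mult_right)
    moreover have "N (\<epsilon> * c powr (- a / 2)) / (\<epsilon> * c powr (- a / 2))\<^sup>2 * c powr (- a)
        = N (\<epsilon> * c powr (- a / 2)) / \<epsilon>\<^sup>2" for \<epsilon>
      unfolding rho2[OF c] using c by simp
    ultimately have "((\<lambda>\<epsilon>. N (\<epsilon> * c powr (- a / 2)) / \<epsilon>\<^sup>2) \<longlongrightarrow> L * c powr (- a)) (at_right 0)"
      by simp
    from tendsto_add[OF tendsto_mult_left[OF limS[OF c], of a] tendsto_mult_left[OF this, of "1 - a"]]
    show ?thesis by (simp add: \<tau>_def add_divide_distrib)
  qed
  have up: "\<forall>\<^sub>F \<epsilon> in at_right 0. X \<epsilon> < l + \<eta>" if \<eta>: "\<eta> > 0" for \<eta>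
  proof -
    consider (zero) "g = 0" | (pos) "g > 0" "L > 0" | (neg) "g > 0" "L \<le> 0" using g by linarith
    then show ?thesis
    proof cases
      case zero
      \<comment> \<open>At a critical point \<open>NL\<close> gives nothing and only the bound on
        \<open>N\<close> remains. Its contribution decays like \<open>c powr (- a)\<close>, while
        the \<open>S\<close> term vanishes for fixed \<open>c\<close>, so a large \<open>c\<close>
        is a good competitor.\<close>
      have "((\<lambda>c. (1 - a) * K * c powr (- a)) \<longlongrightarrow> 0) at_top"
        using a by (intro tendsto_mult_right_zero tendsto_neg_powr) (auto intro: filterlim_ident)
      from order_tendstoD(2)[OF this, of "\<eta> / 2"] eventually_gt_at_top[of 0] \<eta>
      obtain c where c: "c > 0" "(1 - a) * K * c powr (- a) < \<eta> / 2"
        by (metis (mono_tags, lifting) eventually_conj eventually_happens' half_gt_zero trivial_limit_at_top_linorder)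
      have "((\<lambda>\<epsilon>. a * (S (\<epsilon>\<^sup>2 * c powr (1 - a)) / \<epsilon>\<^sup>2)) \<longlongrightarrow> a * 0) (at_right 0)"
        using limS[OF c(1)] zero by (intro tendsto_mult_left) simp
      from order_tendstoD(2)[OF this, of "\<eta> / 2"] \<eta>
      have "\<forall>\<^sub>F \<epsilon> in at_right 0. a * (S (\<epsilon>\<^sup>2 * c powr (1 - a)) / \<epsilon>\<^sup>2) < \<eta> / 2" by simp
      with order_tendstoD(2)[OF rad_fixed(2)[of c] r0] pos
      have "\<forall>\<^sub>F \<epsilon> in at_right 0. \<tau> \<epsilon> c / \<epsilon>\<^sup>2 < l + \<eta>"
      proof eventually_elim
        case (elim \<epsilon>)
        then have "N (\<epsilon> * c powr (- a / 2)) / \<epsilon>\<^sup>2 \<le> K * (\<epsilon>\<^sup>2 * c powr (- a)) / \<epsilon>\<^sup>2"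
          using N[of "\<epsilon> * c powr (- a / 2)"] c unfolding rho2[OF c(1)]
          by (intro divide_right_mono) auto
        then have "(1 - a) * (N (\<epsilon> * c powr (- a / 2)) / \<epsilon>\<^sup>2) \<le> (1 - a) * (K * c powr (- a))"
          using a elim by (intro mult_left_mono) auto
        moreover have "\<tau> \<epsilon> c / \<epsilon>\<^sup>2 = a * (S (\<epsilon>\<^sup>2 * c powr (1 - a)) / \<epsilon>\<^sup>2)
            + (1 - a) * (N (\<epsilon> * c powr (- a / 2)) / \<epsilon>\<^sup>2)"
          by (simp add: \<tau>_def add_divide_distrib)
        ultimately show ?case using elim(3) c(2) l0 unfolding mult.assoc by linarith
      qed
      then show ?thesis by (rule upper[OF c(1) \<eta>])
    next
      case pos
      have c: "L / g > 0" using pos by simp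
      \<comment> \<open>At the minimizer both terms of the weighted mean equal \<open>l\<close>, the
        equality case of the weighted AM-GM inequality.\<close>
      have "(L / g) powr (1 - a) * g = l"
        using pos by (simp add: l_def powr_divide powr_diff)
      moreover have "L * (L / g) powr (- a) = l"
        using pos by (simp add: l_def powr_divide powr_diff powr_minus field_simps)
      ultimately have "a * ((L / g) powr (1 - a) * g) + (1 - a) * (L * (L / g) powr (- a)) < l + \<eta>"
        using \<eta> by (simp add: algebra_simps)
      from order_tendstoD(2)[OF limT[OF c pos(1)] this] show ?thesis by (rule upper[OF c \<eta>])
    next
      case neg
      \<comment> \<open>For \<open>L \<le> 0\<close> the averaging term is nonpositive in the limit,
        and a small fixed \<open>c\<close> makes the gradient term smaller than
        \<open>\<eta>\<close>.\<close>
      have "((\<lambda>c. a * (c powr (1 - a) * g)) \<longlongrightarrow> a * (0 powr (1 - a) * g)) (at_right 0)"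
        using a by (intro tendsto_intros tendsto_powr') (auto simp: eventually_at_filter)
      then have "((\<lambda>c. a * (c powr (1 - a) * g)) \<longlongrightarrow> 0) (at_right 0)" by simp
      from eventually_happens'[OF _ eventually_conj[OF order_tendstoD(2)[OF this \<eta>] pos]]
      obtain c where c: "c > 0" "a * (c powr (1 - a) * g) < \<eta>" by auto
      have "(1 - a) * (L * c powr (- a)) \<le> 0"
        using neg a by (intro mult_nonneg_nonpos mult_nonpos_nonneg) auto
      then have "a * (c powr (1 - a) * g) + (1 - a) * (L * c powr (- a)) < l + \<eta>"
        using c l0 by linarith
      from order_tendstoD(2)[OF limT[OF c(1) neg(1)] this] show ?thesis by (rule upper[OF c(1) \<eta>])
    qed
  qed
  have low: "\<forall>\<^sub>F \<epsilon> in at_right 0. X \<epsilon> > l - \<eta>" if \<eta>: "\<eta> > 0" for \<eta>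
  proof (cases "L > 0 \<and> g > 0")
    case False
    \<comment> \<open>One factor of \<open>l\<close> is a power of 0, hence 0, and the maximum with
      0 in \<open>X\<close> makes the lower bound immediate.\<close>
    then have "l = 0" using g a by (auto simp: l_def max_def)
    then show ?thesis using \<eta> by (simp add: X_def less_le_trans[of "-\<eta>" 0])
  next
    case True
    then have L: "L > 0" and g: "g > 0" by auto
    \<comment> \<open>The lower bound must hold for all \<open>c\<close> in the interval at once.
      Hence \<open>L\<close> is replaced by a fixed \<open>L' < L\<close> that costs less than
      \<open>\<eta> / 2\<close>, and \<open>N \<rho> \<ge> L' * \<rho>\<^sup>2\<close> then holds
      for every small \<open>\<rho>\<close>.\<close>
    have "((\<lambda>x. x powr (1 - a) * g powr a) \<longlongrightarrow> L powr (1 - a) * g powr a) (at_left L)"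
      using L by (intro tendsto_intros) auto
    then have "((\<lambda>x. x powr (1 - a) * g powr a) \<longlongrightarrow> l) (at_left L)"
      using L by (simp add: l_def)
    from order_tendstoD(1)[OF this, of "l - \<eta> / 2"] \<eta>
    have "\<forall>\<^sub>F x in at_left L. x powr (1 - a) * g powr a > l - \<eta> / 2" by simp
    moreover have "\<forall>\<^sub>F x in at_left L. x \<in> {0<..<L}"
      using L by (intro eventually_at_leftI[of 0]) auto
    ultimately obtain L' where L': "0 < L'" "L' < L" "L' powr (1 - a) * g powr a > l - \<eta> / 2"
      using eventually_happens'[OF _ eventually_conj] by (metis (no_types, lifting) greaterThanLessThan_iff trivial_limit_at_left_real)
    from order_tendstoD(1)[OF NL[OF g] L'(2)]
    have "\<forall>\<^sub>F \<rho> in at_right 0. L' < N \<rho> / \<rho>\<^sup>2" .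
    then obtain \<rho>0 where \<rho>0: "\<rho>0 > 0" "\<And>\<rho>. 0 < \<rho> \<Longrightarrow> \<rho> < \<rho>0 \<Longrightarrow> L' < N \<rho> / \<rho>\<^sup>2"
      unfolding eventually_at_right_field by auto
    \<comment> \<open>This bounds, uniformly in \<open>c\<close>, the weighted quadratic error of
      \<open>S\<close> after division by \<open>\<epsilon>\<^sup>2\<close>.\<close>
    have "((\<lambda>\<epsilon>. a * K * (\<epsilon> * M \<epsilon> powr (1 - a))\<^sup>2) \<longlongrightarrow> a * K * 0\<^sup>2) (at_right 0)"
      using small_S by (intro tendsto_intros)
    then have "((\<lambda>\<epsilon>. a * K * (\<epsilon> * M \<epsilon> powr (1 - a))\<^sup>2) \<longlongrightarrow> 0) (at_right 0)" by simp
    from order_tendstoD(2)[OF this, of "\<eta> / 2"] \<eta>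
    have "\<forall>\<^sub>F \<epsilon> in at_right 0. a * K * (\<epsilon> * M \<epsilon> powr (1 - a))\<^sup>2 < \<eta> / 2" by simp
    with pos evS[OF r0] evN[OF \<rho>0(1)] mM[OF zero_less_one] show ?thesis
    proof eventually_elim
      case (elim \<epsilon>)
      then have \<epsilon>: "0 < \<epsilon>" "\<epsilon> < 1" by auto
      have "\<epsilon>\<^sup>2 * (l - \<eta> / 2 - a * K * (\<epsilon> * M \<epsilon> powr (1 - a))\<^sup>2) \<le> \<tau> \<epsilon> c" if c: "c \<in> {m \<epsilon>..M \<epsilon>}" for c
      proof -
        let ?r = "\<epsilon>\<^sup>2 * c powr (1 - a)" and ?\<rho> = "\<epsilon> * c powr (- a / 2)"
        have c0: "c > 0" using c m0[OF \<epsilon>(1)] by auto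
        have "\<epsilon> * (\<epsilon> * M \<epsilon> powr (1 - a)) \<le> \<epsilon> * M \<epsilon> powr (1 - a)"
          using \<epsilon> by (intro mult_left_le_one_le) auto
        then have r: "0 < ?r" "?r < r0" and \<rho>: "0 < ?\<rho>" "?\<rho> < \<rho>0"
          using radS[OF \<epsilon>(1) c] radN[OF \<epsilon>(1) c] elim by linarith+
        have "?r\<^sup>2 \<le> (\<epsilon> * (\<epsilon> * M \<epsilon> powr (1 - a)))\<^sup>2"
          using r radS[OF \<epsilon>(1) c] by (intro power_mono) auto
        then have "K * ?r\<^sup>2 \<le> K * (\<epsilon>\<^sup>2 * (\<epsilon> * M \<epsilon> powr (1 - a))\<^sup>2)"
          using K by (simp add: power_mult_distrib)
        then have S': "S ?r \<ge> ?r * g - K * (\<epsilon>\<^sup>2 * (\<epsilon> * M \<epsilon> powr (1 - a))\<^sup>2)"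
          using S[OF r] by linarith
        have "0 < ?\<rho>\<^sup>2" using \<rho>(1) by (rule zero_less_power)
        with \<rho>0(2)[OF \<rho>] have "N ?\<rho> \<ge> L' * ?\<rho>\<^sup>2" by (simp only: pos_less_divide_eq less_imp_le)
        then have N': "N ?\<rho> \<ge> \<epsilon>\<^sup>2 * (L' * c powr (- a))" unfolding rho2[OF c0] by (simp only: mult_ac)
        have "l - \<eta> / 2 \<le> L' powr (1 - a) * g powr a" using L' by simp
        \<comment> \<open>The powers of \<open>c\<close> cancel in this weighted geometric mean, so
          the bound obtained from Young's inequality does not depend on \<open>c\<close>.\<close>
        also have "\<dots> = (c powr (1 - a) * g) powr a * (L' * c powr (- a)) powr (1 - a)"
        proof -
          have "c powr ((1 - a) * a) * c powr (- a * (1 - a)) = 1"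
            using c0 by (simp add: powr_add[symmetric] algebra_simps)
          then show ?thesis using c0 L' g by (simp add: powr_mult powr_powr mult_ac)
        qed
        also have "\<dots> \<le> a * (c powr (1 - a) * g) + (1 - a) * (L' * c powr (- a))"
          using a c0 g L' by (intro Youngs_inequality_0) auto
        finally have "\<epsilon>\<^sup>2 * (l - \<eta> / 2) \<le> \<epsilon>\<^sup>2 * (a * (c powr (1 - a) * g) + (1 - a) * (L' * c powr (- a)))"
          by (intro mult_left_mono) auto
        then have "\<epsilon>\<^sup>2 * (l - \<eta> / 2 - a * K * (\<epsilon> * M \<epsilon> powr (1 - a))\<^sup>2)
            \<le> a * (?r * g - K * (\<epsilon>\<^sup>2 * (\<epsilon> * M \<epsilon> powr (1 - a))\<^sup>2)) + (1 - a) * (\<epsilon>\<^sup>2 * (L' * c powr (- a)))"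
          by (simp add: algebra_simps)
        also have "\<dots> \<le> \<tau> \<epsilon> c"
          unfolding \<tau>_def using S' N' a by (intro add_mono mult_left_mono) auto
        finally show ?thesis .
      qed
      then have "\<epsilon>\<^sup>2 * (l - \<eta> / 2 - a * K * (\<epsilon> * M \<epsilon> powr (1 - a))\<^sup>2) \<le> (INF c\<in>{m \<epsilon>..M \<epsilon>}. \<tau> \<epsilon> c)"
        using elim by (intro cINF_greatest) auto
      then have "\<epsilon>\<^sup>2 * (l - \<eta> / 2 - a * K * (\<epsilon> * M \<epsilon> powr (1 - a))\<^sup>2) \<le> max (INF c\<in>{m \<epsilon>..M \<epsilon>}. \<tau> \<epsilon> c) 0"
        by (simp add: le_max_iff_disj)
      then have "l - \<eta> / 2 - a * K * (\<epsilon> * M \<epsilon> powr (1 - a))\<^sup>2 \<le> X \<epsilon>"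
        using \<epsilon> by (simp add: X_def field_simps)
      then show ?case using elim by linarith
    qed
  qed
  have "(X \<longlongrightarrow> l) (at_right 0)"
  proof (rule order_tendstoI)
    fix y assume "y < l"
    then show "\<forall>\<^sub>F \<epsilon> in at_right 0. y < X \<epsilon>" using low[of "l - y"] by simp
  next
    fix y assume "l < y"
    then show "\<forall>\<^sub>F \<epsilon> in at_right 0. X \<epsilon> < y" using up[of "y - l"] by simp
  qed
  then show ?limit unfolding X_def \<tau>_def l_def .
  show ?bdd using bdd unfolding \<tau>_def .
qed

section \<open>Consistency of the mean value formula\<close>

lemma tendsto_powr_at_right_0:
  fixes e :: real
  assumes "e > 0"
  shows "((\<lambda>\<epsilon>. \<epsilon> powr e) \<longlongrightarrow> 0) (at_right 0)"
proof -
  have "((\<lambda>\<epsilon>. \<epsilon> powr e) \<longlongrightarrow> 0 powr e) (at_right 0)"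
    using assms by (intro tendsto_powr') (auto simp: eventually_at_filter)
  then show ?thesis by simp
qed

lemma exp_alpha_bounds: "p > 2 \<Longrightarrow> 0 < exp_alpha p \<and> exp_alpha p < 1"
  by (simp add: exp_alpha_def)

lemma one_minus_exp_alpha: "p > 2 \<Longrightarrow> 1 - exp_alpha p = 1 / (p - 1)"
  by (simp add: exp_alpha_def field_simps)

lemma lower_cutoff_tendsto:
  assumes p: "p > 2"
  shows "(lower_cutoff p \<longlongrightarrow> 0) (at_right 0)"
  unfolding lower_cutoff_def[abs_def] using p by (intro tendsto_powr_at_right_0) simp

lemma upper_cutoff_at_top:
  assumes p: "p > 2"
  shows "filterlim (upper_cutoff p) at_top (at_right 0)"
proof -
  have "2 / p < 1" using p by simp
  then have "filterlim (\<lambda>\<epsilon>::real. inverse (\<epsilon> powr (2 - 2 / p))) at_top (at_right 0)"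
    by (intro filterlim_inverse_at_top tendsto_powr_at_right_0) (auto simp: eventually_at_filter)
  moreover have "inverse (\<epsilon> powr (2 - 2 / p)) = upper_cutoff p \<epsilon>" for \<epsilon>
    by (simp add: upper_cutoff_def powr_minus[symmetric])
  ultimately show ?thesis by simp
qed

text \<open>The product is the positive power \<open>\<epsilon> powr (1 - 2 / p)\<close>. So the
  largest radius of the outer suprema is of smaller order than \<open>\<epsilon>\<close>, and an
  error quadratic in it is negligible against \<open>\<epsilon>\<^sup>2\<close>.\<close>

lemma upper_cutoff_radius:
  assumes p: "p > 2"
  shows "((\<lambda>\<epsilon>. \<epsilon> * upper_cutoff p \<epsilon> powr (1 - exp_alpha p)) \<longlongrightarrow> 0) (at_right 0)"
proof (rule Lim_transform_eventually)
  show "((\<lambda>\<epsilon>. \<epsilon> powr (1 - 2 / p)) \<longlongrightarrow> 0) (at_right 0)"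
    using p by (intro tendsto_powr_at_right_0) simp
  have e: "1 - 2 / p = 1 + (- 2 + 2 / p) * (1 - exp_alpha p)"
    unfolding one_minus_exp_alpha[OF p] using p by (simp add: divide_simps) (simp add: algebra_simps)
  have "\<epsilon> powr (1 - 2 / p) = \<epsilon> * upper_cutoff p \<epsilon> powr (1 - exp_alpha p)" if "\<epsilon> > 0" for \<epsilon>
    unfolding e powr_add[of \<epsilon> 1] upper_cutoff_def powr_powr using that by simp
  then show "\<forall>\<^sub>F \<epsilon> in at_right 0. \<epsilon> powr (1 - 2 / p) = \<epsilon> * upper_cutoff p \<epsilon> powr (1 - exp_alpha p)"
    by (simp add: eventually_at_filter)
qed

text \<open>The exponent \<open>k\<close> of the lower cutoff solves
  \<open>k = 1 - k * exp_alpha p / 2\<close>, so the product is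
  \<open>lower_cutoff p \<epsilon>\<close> itself.\<close>

lemma lower_cutoff_radius:
  assumes p: "p > 2"
  shows "((\<lambda>\<epsilon>. \<epsilon> * lower_cutoff p \<epsilon> powr (- exp_alpha p / 2)) \<longlongrightarrow> 0) (at_right 0)"
proof (rule Lim_transform_eventually)
  let ?k = "2 * (p - 1) / (3 * p - 4)"
  show "((\<lambda>\<epsilon>. \<epsilon> powr ?k) \<longlongrightarrow> 0) (at_right 0)"
    using p by (intro tendsto_powr_at_right_0) simp
  have e: "?k = 1 + ?k * (- exp_alpha p / 2)"
    unfolding exp_alpha_def using p by (simp add: divide_simps) (simp add: algebra_simps)
  have "\<epsilon> powr ?k = \<epsilon> * lower_cutoff p \<epsilon> powr (- exp_alpha p / 2)" if "\<epsilon> > 0" for \<epsilon>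
    by (subst e, unfold powr_add lower_cutoff_def powr_powr) (use that in simp)
  then show "\<forall>\<^sub>F \<epsilon> in at_right 0. \<epsilon> powr ?k = \<epsilon> * lower_cutoff p \<epsilon> powr (- exp_alpha p / 2)"
    by (simp add: eventually_at_filter)
qed

section \<open>Limit of the nonlinear average\<close>

definition upper_op :: "real \<Rightarrow> real \<Rightarrow> ('a::euclidean_space \<Rightarrow> real) \<Rightarrow> 'a \<Rightarrow> real" where
  "upper_op p \<epsilon> f x = (INF c\<in>{lower_cutoff p \<epsilon>..upper_cutoff p \<epsilon>}.
    exp_alpha p * (SUP y\<in>ball x (\<epsilon>\<^sup>2 * c powr (1 - exp_alpha p)). f y)
      + (1 - exp_alpha p) * mean_op p (\<epsilon> * c powr (- exp_alpha p / 2)) f x)"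

text \<open>Negating \<open>f\<close> exchanges suprema and infima, hence the two halves of
  \<open>A_op\<close>. The identity is exact for every \<open>f\<close> and
  \<open>\<epsilon>\<close>, because \<open>Inf\<close> on \<open>real\<close> is by definition the
  negated \<open>Sup\<close> of the negated set, even when the set is unbounded.\<close>

lemma A_op_eq_upper_op:
  "A_op p \<epsilon> f x = (max (upper_op p \<epsilon> f x) (f x) - max (upper_op p \<epsilon> (\<lambda>y. - f y) x) (- f x)) / 2"
proof -
  let ?I = "{lower_cutoff p \<epsilon>..upper_cutoff p \<epsilon>}"
  let ?h = "\<lambda>c. exp_alpha p * (INF y\<in>ball x (\<epsilon>\<^sup>2 * c powr (1 - exp_alpha p)). f y)
      + (1 - exp_alpha p) * mean_op p (\<epsilon> * c powr (- exp_alpha p / 2)) f x"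
  have "upper_op p \<epsilon> (\<lambda>y. - f y) x = (INF c\<in>?I. - ?h c)"
    unfolding upper_op_def mean_op_uminus INF_eq_uminus_SUP[of f] by (simp add: algebra_simps)
  also have "\<dots> = - (SUP c\<in>?I. ?h c)"
    by (simp add: INF_eq_uminus_SUP)
  finally have "max (upper_op p \<epsilon> (\<lambda>y. - f y) x) (- f x) = - min (SUP c\<in>?I. ?h c) (f x)"
    by (simp add: minus_min_eq_max)
  then show ?thesis
    unfolding A_op_def Let_def upper_op_def by simp
qed

lemma cINF_diff_const:
  fixes h :: "'b \<Rightarrow> real"
  assumes I: "I \<noteq> {}" and bdd: "bdd_below ((\<lambda>c. h c - k) ` I)"
  shows "(INF c\<in>I. h c) - k = (INF c\<in>I. h c - k)"
proof (rule antisym)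
  from bdd obtain m where m: "\<And>c. c \<in> I \<Longrightarrow> m \<le> h c - k" by (auto simp: bdd_below_def)
  have bdd': "bdd_below (h ` I)" by (rule bdd_belowI2[of _ "m + k"]) (use m in force)
  show "(INF c\<in>I. h c) - k \<le> (INF c\<in>I. h c - k)"
    using I bdd' by (intro cINF_greatest) (auto intro: cINF_lower)
  have "(INF c\<in>I. h c - k) + k \<le> (INF c\<in>I. h c)"
  proof (rule cINF_greatest[OF I])
    fix c assume "c \<in> I"
    then have "(INF c\<in>I. h c - k) \<le> h c - k" using bdd by (intro cINF_lower)
    then show "(INF c\<in>I. h c - k) + k \<le> h c" by simp
  qed
  then show "(INF c\<in>I. h c - k) \<le> (INF c\<in>I. h c) - k" by simp
qed

text \<open>The weights \<open>exp_alpha p\<close> and \<open>1 - exp_alpha p\<close> add up to one,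
  so \<open>f x\<close> can be taken out of the bracket. What remains are increments of the kind
  treated in \<open>INF_family_limit\<close>, with \<open>norm g\<close> as the slope.\<close>

lemma upper_op_limit:
  fixes f :: "'a::euclidean_space \<Rightarrow> real"
  assumes p: "p > 2" and exp: "second_order_expansion f x g H" and R: "R > 0"
    and cont: "continuous_on (ball x R) f"
  defines "L \<equiv> (\<Sum>b\<in>Basis. H b \<bullet> b) + (p - 2) * (H (sgn g) \<bullet> sgn g)"
  shows "((\<lambda>\<epsilon>. (max (upper_op p \<epsilon> f x) (f x) - f x) / \<epsilon>\<^sup>2)
    \<longlongrightarrow> max L 0 powr (1 - exp_alpha p) * norm g powr exp_alpha p) (at_right 0)"
proof -
  let ?a = "exp_alpha p"
  define S where "S r = (SUP y\<in>ball x r. f y) - f x" for r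
  define N where "N \<rho> = mean_op p \<rho> f x - f x" for \<rho>
  from second_order_expansion_first_order[OF exp] obtain K1 \<delta>1 where K1: "K1 > 0" "\<delta>1 > 0"
    and T: "\<And>h. norm h < \<delta>1 \<Longrightarrow> \<bar>f (x + h) - f x - g \<bullet> h\<bar> \<le> K1 * (norm h)\<^sup>2"
    by blast
  from mean_op_first_order[OF p exp R cont] obtain K2 \<delta>2 where K2: "K2 > 0" "\<delta>2 > 0"
    and M: "\<And>\<rho>. 0 < \<rho> \<Longrightarrow> \<rho> < \<delta>2 \<Longrightarrow> \<bar>N \<rho>\<bar> \<le> K2 * \<rho>\<^sup>2"
    unfolding N_def by blast
  define K r0 where "K = max K1 K2" and "r0 = min \<delta>1 \<delta>2"
  have K: "K > 0" "r0 > 0" using K1 K2 by (auto simp: K_def r0_def)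
  have S: "\<bar>S r - r * norm g\<bar> \<le> K * r\<^sup>2" if r: "0 < r" "r < r0" for r
  proof -
    have "\<bar>S r - r * norm g\<bar> \<le> K1 * r\<^sup>2"
      unfolding S_def by (rule SUP_ball_first_order(1)[of r \<delta>1]) (use r K1 T in \<open>auto simp: r0_def\<close>)
    also have "\<dots> \<le> K * r\<^sup>2" by (intro mult_right_mono) (auto simp: K_def)
    finally show ?thesis .
  qed
  have N: "\<bar>N \<rho>\<bar> \<le> K * \<rho>\<^sup>2" if \<rho>: "0 < \<rho>" "\<rho> < r0" for \<rho>
  proof -
    have "\<bar>N \<rho>\<bar> \<le> K2 * \<rho>\<^sup>2" using M \<rho> by (simp add: r0_def)
    also have "\<dots> \<le> K * \<rho>\<^sup>2" by (intro mult_right_mono) (auto simp: K_def)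
    finally show ?thesis .
  qed
  have NL: "((\<lambda>\<rho>. N \<rho> / \<rho>\<^sup>2) \<longlongrightarrow> L) (at_right 0)" if g: "norm g > 0"
  proof (rule tendstoI)
    fix \<eta> :: real assume \<eta>: "\<eta> > 0"
    from mean_op_second_order[OF p exp R cont, of "\<eta> / 2"] g \<eta> obtain \<delta> where \<delta>: "\<delta> > 0"
      and D: "\<And>\<rho>. 0 < \<rho> \<Longrightarrow> \<rho> < \<delta> \<Longrightarrow> \<bar>N \<rho> - \<rho>\<^sup>2 * L\<bar> \<le> \<eta> / 2 * \<rho>\<^sup>2"
      unfolding N_def L_def by auto
    have "dist (N \<rho> / \<rho>\<^sup>2) L < \<eta>" if \<rho>: "0 < \<rho>" "\<rho> < \<delta>" for \<rho>
    proof -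
      have "N \<rho> / \<rho>\<^sup>2 - L = (N \<rho> - \<rho>\<^sup>2 * L) / \<rho>\<^sup>2" using \<rho> by (simp add: diff_divide_distrib)
      then have "\<bar>N \<rho> / \<rho>\<^sup>2 - L\<bar> = \<bar>N \<rho> - \<rho>\<^sup>2 * L\<bar> / \<rho>\<^sup>2" by (simp add: abs_divide)
      also have "\<dots> \<le> \<eta> / 2 * \<rho>\<^sup>2 / \<rho>\<^sup>2" using D[OF \<rho>] by (intro divide_right_mono) auto
      also have "\<dots> < \<eta>" using \<rho> \<eta> by simp
      finally show ?thesis by (simp add: dist_real_def)
    qed
    then show "\<forall>\<^sub>F \<rho> in at_right 0. dist (N \<rho> / \<rho>\<^sup>2) L < \<eta>"
      using \<delta> by (intro eventually_at_rightI[of 0 \<delta>]) auto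
  qed
  have pos: "0 < \<epsilon> \<Longrightarrow> lower_cutoff p \<epsilon> > 0" for \<epsilon> by (simp add: lower_cutoff_def)
  have a: "0 < ?a" "?a < 1" using exp_alpha_bounds[OF p] by auto
  let ?I = "\<lambda>\<epsilon>. {lower_cutoff p \<epsilon>..upper_cutoff p \<epsilon>}"
  let ?t = "\<lambda>\<epsilon> c. ?a * S (\<epsilon>\<^sup>2 * c powr (1 - ?a)) + (1 - ?a) * N (\<epsilon> * c powr (- ?a / 2))"
  note cutoffs = lower_cutoff_tendsto[OF p] upper_cutoff_at_top[OF p]
    upper_cutoff_radius[OF p] lower_cutoff_radius[OF p]
  have lim: "((\<lambda>\<epsilon>. max (INF c\<in>?I \<epsilon>. ?t \<epsilon> c) 0 / \<epsilon>\<^sup>2)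
      \<longlongrightarrow> max L 0 powr (1 - ?a) * norm g powr ?a) (at_right 0)"
    by (rule INF_family_limit(1)[OF a norm_ge_zero K]) (fact S N NL pos cutoffs)+
  have bdd: "\<forall>\<^sub>F \<epsilon> in at_right 0. bdd_below (?t \<epsilon> ` ?I \<epsilon>)"
    by (rule INF_family_limit(2)[OF a norm_ge_zero K]) (fact S N NL pos cutoffs)+
  \<comment> \<open>Moving the constant \<open>f x\<close> through the infimum uses a nonempty index
    set and a lower bound; \<open>c = 1\<close> witnesses the former.\<close>
  have "\<forall>\<^sub>F \<epsilon> in at_right 0. 1 \<in> ?I \<epsilon>"
    using order_tendstoD(2)[OF lower_cutoff_tendsto[OF p] zero_less_one]
      upper_cutoff_at_top[OF p, unfolded filterlim_at_top, rule_format, of 1]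
    by eventually_elim auto
  with bdd have "\<forall>\<^sub>F \<epsilon> in at_right 0. max (INF c\<in>?I \<epsilon>. ?t \<epsilon> c) 0 / \<epsilon>\<^sup>2
      = (max (upper_op p \<epsilon> f x) (f x) - f x) / \<epsilon>\<^sup>2"
  proof eventually_elim
    case (elim \<epsilon>)
    let ?h = "\<lambda>c. ?a * (SUP y\<in>ball x (\<epsilon>\<^sup>2 * c powr (1 - ?a)). f y)
      + (1 - ?a) * mean_op p (\<epsilon> * c powr (- ?a / 2)) f x"
    have t: "?t \<epsilon> c = ?h c - f x" for c by (simp add: S_def N_def algebra_simps)
    have "bdd_below ((\<lambda>c. ?h c - f x) ` ?I \<epsilon>)" using elim(1) unfolding t .
    moreover have "?I \<epsilon> \<noteq> {}" using elim(2) by blast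
    ultimately have "upper_op p \<epsilon> f x - f x = (INF c\<in>?I \<epsilon>. ?t \<epsilon> c)"
      unfolding upper_op_def t by (intro cINF_diff_const)
    then show ?case by (simp add: max_def)
  qed
  from Lim_transform_eventually[OF lim this] show ?thesis .
qed

lemma signed_powr_mult:
  assumes "k \<ge> 0"
  shows "signed_powr (k * s) q = k powr q * signed_powr s q"
  using assms by (cases "k = 0") (simp_all add: signed_powr_def sgn_mult abs_mult powr_mult)

text \<open>The halves for \<open>f\<close> and \<open>-f\<close> contribute the positive and the
  negative part of \<open>L\<close>, which join to a signed power. The factor
  \<open>norm g powr exp_alpha p\<close> is the power \<open>1 / (p - 1)\<close> of
  \<open>norm g powr (p - 2)\<close>. At \<open>g = 0\<close> the limit is 0 regardless of
  \<open>L\<close>.\<close>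

lemma A_op_limit:
  fixes f :: "'a::euclidean_space \<Rightarrow> real"
  assumes p: "p > 2" and exp: "second_order_expansion f x g H" and R: "R > 0"
    and cont: "continuous_on (ball x R) f"
  defines "L \<equiv> (\<Sum>b\<in>Basis. H b \<bullet> b) + (p - 2) * (H (sgn g) \<bullet> sgn g)"
  shows "((\<lambda>\<epsilon>. (A_op p \<epsilon> f x - f x) / \<epsilon>\<^sup>2)
    \<longlongrightarrow> signed_powr (norm g powr (p - 2) * L) (1 / (p - 1)) / 2) (at_right 0)"
proof -
  have lin: "linear H" using exp unfolding second_order_expansion_def by (auto intro: bounded_linear.linear)
  let ?l = "\<lambda>L. max L 0 powr (1 - exp_alpha p) * norm g powr exp_alpha p"
  have "(\<Sum>b\<in>Basis. - H b \<bullet> b) + (p - 2) * (- H (sgn (- g)) \<bullet> sgn (- g)) = - L"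
    by (simp add: L_def sgn_minus linear_neg[OF lin] sum_negf)
  with upper_op_limit[OF p second_order_expansion_uminus[OF exp] R continuous_on_minus[OF cont]]
  have "((\<lambda>\<epsilon>. (max (upper_op p \<epsilon> (\<lambda>y. - f y) x) (- f x) - - f x) / \<epsilon>\<^sup>2) \<longlongrightarrow> ?l (- L)) (at_right 0)"
    by simp
  from tendsto_divide[OF tendsto_diff[OF upper_op_limit[OF p exp R cont] this] tendsto_const[of 2]]
  have "((\<lambda>\<epsilon>. (A_op p \<epsilon> f x - f x) / \<epsilon>\<^sup>2) \<longlongrightarrow> (?l L - ?l (- L)) / 2) (at_right 0)"
    by (simp add: A_op_eq_upper_op L_def diff_divide_distrib add_divide_distrib mult.commute)
  moreover have "?l L - ?l (- L) = signed_powr (norm g powr (p - 2) * L) (1 / (p - 1))"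
  proof -
    have "signed_powr (norm g powr (p - 2) * L) (1 / (p - 1))
        = norm g powr exp_alpha p * signed_powr L (1 / (p - 1))"
      by (simp add: signed_powr_mult powr_powr exp_alpha_def)
    moreover have "max L 0 powr q - max (- L) 0 powr q = signed_powr L q" for q
      by (simp add: signed_powr_def sgn_if)
    ultimately show ?thesis
      by (simp add: one_minus_exp_alpha[OF p] left_diff_distrib[symmetric])
  qed
  ultimately show ?thesis by simp
qed

section \<open>Test functions on space-time cylinders\<close>

lemma gradient_eq: "GDERIV f x :> D \<Longrightarrow> gradient f x = D"
  unfolding gradient_def
proof (rule the_equality)
  fix D' assume "GDERIV f x :> D'" and "GDERIV f x :> D"
  then have "(\<lambda>h. h \<bullet> D') = (\<lambda>h. h \<bullet> D)"
    unfolding gderiv_def by (rule has_derivative_unique)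
  then show "D' = D" by (metis vector_eq_ldot)
qed

text \<open>The quotient splits into a spatial increment on the slice at time \<open>t\<close>,
  handled by \<open>A_op_limit\<close>, and a time increment over
  \<open>\<epsilon>\<^sup>2 / 2\<close>, which gives half the time derivative.\<close>

lemma amvf_quotient_tendsto:
  fixes \<phi> :: "'a::euclidean_space \<times> real \<Rightarrow> real"
  assumes p: "p > 2" and R: "R > 0" and C2: "C2_on (ball x R \<times> {t - R..t + R}) \<phi>"
  shows "(amvf_quotient p \<phi> x t \<longlongrightarrow>
    (signed_powr (p_laplacian p (\<lambda>y. \<phi> (y, t)) x) (1 / (p - 1)) - deriv (\<lambda>s. \<phi> (x, s)) t) / 2)
      (at_right 0)"
proof -
  define S where "S = ball x R \<times> {t - R..t + R}"
  define f where "f y = \<phi> (y, t)" for y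
  from C2 obtain G H where
    G0: "\<And>z. z \<in> S \<Longrightarrow> (\<phi> has_derivative (\<lambda>h. G z \<bullet> h)) (at z within S)" and
    H0: "\<And>z. z \<in> S \<Longrightarrow> (G has_derivative blinfun_apply (H z)) (at z within S)"
    unfolding C2_on_def S_def by blast
  \<comment> \<open>The slice at time \<open>t\<close> lies in the interior of the cylinder, so the
    derivatives within \<open>S\<close> are full derivatives there.\<close>
  have int: "(y, t) \<in> interior S" if "y \<in> ball x R" for y
    using that R by (simp add: S_def interior_Times)
  have G: "(\<phi> has_derivative (\<lambda>h. G (y, t) \<bullet> h)) (at (y, t))"
    and H: "(G has_derivative blinfun_apply (H (y, t))) (at (y, t))" if "y \<in> ball x R" for y
    using G0 H0 at_within_interior[OF int[OF that]] subsetD[OF interior_subset int[OF that]]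
    by metis+
  define Gf where "Gf y = fst (G (y, t))" for y
  define Hf where "Hf h = fst (blinfun_apply (H (x, t)) (h, 0))" for h
  have slice: "((\<lambda>y. (y, t)) has_derivative (\<lambda>h. (h, 0))) (at y)" for y :: 'a
    by (auto intro!: derivative_eq_intros)
  have f': "(f has_derivative (\<lambda>h. Gf y \<bullet> h)) (at y)" if "y \<in> ball x R" for y
    using has_derivative_compose[OF slice G[OF that]] by (simp add: f_def[abs_def] Gf_def inner_prod_def)
  have xR: "x \<in> ball x R" using R by simp
  have Gf': "(Gf has_derivative Hf) (at x)"
    unfolding Gf_def[abs_def] Hf_def[abs_def]
    using has_derivative_compose[OF slice H[OF xR]] by (rule has_derivative_fst)
  have exp: "second_order_expansion f x (Gf x) Hf"
    unfolding second_order_expansion_def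
    using second_order_taylor[OF R f' Gf'] has_derivative_bounded_linear[OF Gf'] by blast
  have cont: "continuous_on (ball x R) f"
    by (intro continuous_at_imp_continuous_on ballI has_derivative_continuous[OF f'])
  have grad: "gradient f y = Gf y" if "y \<in> ball x R" for y
    by (rule gradient_eq) (use f'[OF that] in \<open>simp add: gderiv_def inner_commute\<close>)
  have grad': "(gradient f has_derivative Hf) (at x)"
    by (rule has_derivative_transform_within_open[OF Gf' open_ball xR]) (simp add: grad)
  then have fd: "frechet_derivative (gradient f) (at x) = Hf" by (rule frechet_derivative_at[symmetric])
  \<comment> \<open>The formula needs no case distinction: at a critical point the factor
    \<open>0 powr (p - 2)\<close> is 0, in agreement with the value of
    \<open>p_laplacian\<close>.\<close>
  have "p_laplacian p f x = norm (Gf x) powr (p - 2)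
      * ((\<Sum>b\<in>Basis. Hf b \<bullet> b) + (p - 2) * (Hf (sgn (Gf x)) \<bullet> sgn (Gf x)))"
    using p_laplacian_nondivergence_form[OF p differentiableI[OF grad']] p
    unfolding fd grad[OF xR] divergence_def sgn_div_norm by (cases "Gf x = 0") simp_all
  with A_op_limit[OF p exp R cont]
  have space: "((\<lambda>\<epsilon>. (A_op p \<epsilon> f x - f x) / \<epsilon>\<^sup>2)
      \<longlongrightarrow> signed_powr (p_laplacian p f x) (1 / (p - 1)) / 2) (at_right 0)"
    by simp
  have "((\<lambda>s. (x, s)) has_derivative (\<lambda>s. (0, s))) (at t)"
    by (auto intro!: derivative_eq_intros)
  from has_derivative_compose[OF this G[OF xR]]
  have time: "((\<lambda>s. \<phi> (x, s)) has_real_derivative snd (G (x, t))) (at t)"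
    by (simp add: inner_prod_def has_field_derivative_def)
  then have dt: "deriv (\<lambda>s. \<phi> (x, s)) t = snd (G (x, t))" by (rule DERIV_imp_deriv)
  \<comment> \<open>The time step tends to 0 without reaching it, so it may be inserted into the
    difference quotient. Dividing by \<open>\<epsilon>\<^sup>2\<close> instead of the step itself
    accounts for the factor 1/2.\<close>
  have "filterlim (\<lambda>\<epsilon>. \<epsilon>\<^sup>2 / 2) (at 0) (at_right (0::real))"
    unfolding filterlim_at by (auto intro!: tendsto_eq_intros simp: eventually_at_filter)
  from filterlim_compose[OF time[unfolded DERIV_def] this]
  have "((\<lambda>\<epsilon>. (\<phi> (x, t + \<epsilon>\<^sup>2 / 2) - \<phi> (x, t)) / (\<epsilon>\<^sup>2 / 2) / 2) \<longlongrightarrow> snd (G (x, t)) / 2) (at_right 0)"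
    by (intro tendsto_divide) auto
  from tendsto_diff[OF space this]
  have "((\<lambda>\<epsilon>. (A_op p \<epsilon> f x - f x) / \<epsilon>\<^sup>2 - (\<phi> (x, t + \<epsilon>\<^sup>2 / 2) - \<phi> (x, t)) / (\<epsilon>\<^sup>2 / 2) / 2)
      \<longlongrightarrow> (signed_powr (p_laplacian p f x) (1 / (p - 1)) - snd (G (x, t))) / 2) (at_right 0)"
    by (simp add: diff_divide_distrib)
  moreover have "(A_op p \<epsilon> f x - f x) / \<epsilon>\<^sup>2 - (\<phi> (x, t + \<epsilon>\<^sup>2 / 2) - \<phi> (x, t)) / (\<epsilon>\<^sup>2 / 2) / 2
      = amvf_quotient p \<phi> x t \<epsilon>" for \<epsilon>
    by (simp add: amvf_quotient_def f_def[abs_def] diff_divide_distrib)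
  ultimately show ?thesis unfolding dt f_def[abs_def] by simp
qed

section \<open>Inversion of signed powers\<close>

lemma signed_powr_mono:
  assumes "q > 0" "s \<le> r"
  shows "signed_powr s q \<le> signed_powr r q"
proof -
  consider "0 < s" | "s \<le> 0" "0 \<le> r" | "r < 0" by linarith
  then show ?thesis
  proof cases
    case 1 then show ?thesis using assms by (simp add: signed_powr_def powr_mono2)
  next
    case 2
    then have "signed_powr s q \<le> 0" "0 \<le> signed_powr r q" by (auto simp: signed_powr_def sgn_if)
    then show ?thesis by linarith
  next
    case 3 then show ?thesis using assms by (simp add: signed_powr_def powr_mono2)
  qed
qed

lemma signed_powr_inverse:
  assumes "q \<noteq> 0"
  shows "signed_powr (signed_powr s q) (1 / q) = s" "signed_powr (signed_powr s (1 / q)) q = s"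
  using assms by (auto simp: signed_powr_def sgn_mult abs_mult powr_powr sgn_if)

text \<open>The signed powers with exponents \<open>q\<close> and \<open>1 / q\<close> are
  increasing and inverse to each other. This moves the power from the time derivative to the
  \<open>p\<close>-Laplacian, where the limit of the quotient carries it.\<close>

lemma signed_powr_le_iff:
  assumes "q > 0"
  shows "signed_powr s q \<le> X \<longleftrightarrow> s \<le> signed_powr X (1 / q)"
    and "X \<le> signed_powr s q \<longleftrightarrow> signed_powr X (1 / q) \<le> s"
  using assms signed_powr_mono[of q] signed_powr_mono[of "1 / q"] signed_powr_inverse[of q]
  by (metis less_irrefl zero_less_divide_1_iff)+

theorem theorem2p7:
  fixes p T :: real
    and \<Omega> :: "'a::euclidean_space set"
    and u :: "'a \<times> real \<Rightarrow> real"
  assumes "p > 2" and "T > 0" and "open \<Omega>"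
    and "continuous_on (\<Omega> \<times> {0<..<T}) u"
  shows "pde_viscosity_solution p \<Omega> T u \<longleftrightarrow> amvf_viscosity_solution p \<Omega> T u"
proof -
  have p1: "p - 1 > 0" using assms(1) by simp
  \<comment> \<open>Since the quotient converges, \<open>Liminf\<close> and \<open>Limsup\<close>
    both equal the limit. Each test condition becomes a statement on the sign of that limit, which
    is the differential inequality for the same test function.\<close>
  have lim: "((\<lambda>\<epsilon>. ereal (amvf_quotient p \<phi> x t \<epsilon>)) \<longlongrightarrow> ereal
    ((signed_powr (p_laplacian p (\<lambda>y. \<phi> (y, t)) x) (1 / (p - 1)) - deriv (\<lambda>s. \<phi> (x, s)) t) / 2)) (at_right 0)"
    if "touches_from_above \<Omega> T \<phi> u x t \<or> touches_from_below \<Omega> T \<phi> u x t" for \<phi> x t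
    using that amvf_quotient_tendsto[OF assms(1), of _ x t \<phi>]
    unfolding touches_from_above_def touches_from_below_def by (auto simp del: ereal_divide_eq)
  have "signed_powr (deriv (\<lambda>s. \<phi> (x, s)) t) (p - 1) \<le> p_laplacian p (\<lambda>y. \<phi> (y, t)) x
      \<longleftrightarrow> Liminf (at_right 0) (\<lambda>\<epsilon>. ereal (amvf_quotient p \<phi> x t \<epsilon>)) \<ge> 0"
    if "touches_from_above \<Omega> T \<phi> u x t" for \<phi> x t
    using lim_imp_Liminf[OF _ lim[OF disjI1[OF that]]] by (simp add: signed_powr_le_iff[OF p1])
  moreover have "signed_powr (deriv (\<lambda>s. \<phi> (x, s)) t) (p - 1) \<ge> p_laplacian p (\<lambda>y. \<phi> (y, t)) x
      \<longleftrightarrow> Limsup (at_right 0) (\<lambda>\<epsilon>. ereal (amvf_quotient p \<phi> x t \<epsilon>)) \<le> 0"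
    if "touches_from_below \<Omega> T \<phi> u x t" for \<phi> x t
    using lim_imp_Limsup[OF _ lim[OF disjI2[OF that]]] by (simp add: signed_powr_le_iff[OF p1])
  ultimately show ?thesis
    unfolding pde_viscosity_solution_def amvf_viscosity_solution_def
      pde_subsolution_def amvf_subsolution_def pde_supersolution_def amvf_supersolution_def
    by auto
qed

end
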